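(* Let $u=(u_1,\ldots,u_p)$ and $v=(v_1,\ldots,v_q)$ be AT systems on $\Delta$ (so that every admissible multi-index is normal, see context). Fix permutations $\pi_s,\pi_{\mathfrak s}$ of $\{1,\ldots,p\}$ and $\pi_t,\pi_{\mathfrak t}$ of $\{1,\ldots,q\}$, with the associated paths $\vec s_\bullet,\vec{\mathfrak s}_\bullet,\vec t_\bullet,\vec{\mathfrak t}_\bullet$, and fix an arbitrary nonzero normalization of every type-I and type-II form involved. Let $\vec n,\vec m$ have all components positive and assume that every shifted multi-index displayed below is componentwise nonnegative. (II) If $|\vec m|=|\vec n|+1$, then $$xB_{\vec n,\vec m}(x)=\sum_{j=1}^q b^j_{\vec n,\vec m}B_{\vec n+\vec{\mathfrak s}_j,\vec m+\vec t_j}(x)+b^0_{\vec n,\vec m}B_{\vec n,\vec m}(x)+\sum_{i=1}^p b^{-i}_{\vec n,\vec m}B_{\vec n-\vec s_i,\vec m-\vec{\mathfrak t}_i}(x),$$ where $$b^{j}_{\vec n,\vec m}=\frac{\int_\Delta x\,A_{\vec n+\vec{\mathfrak s}_{j+1},\vec m+\vec t_{j-1}}B_{\vec n,\vec m}\,\mathrm dw}{\int_\Delta A_{\vec n+\vec{\mathfrak s}_{j+1},\vec m+\vec t_{j-1}}B_{\vec n+\vec{\mathfrak s}_j,\vec m+\vec t_j}\,\mathrm dw}\ (1\le j\le q),\qquad b^0_{\vec n,\vec m}=\frac{\int_\Delta x\,A_{\vec n+\vec{\mathfrak s}_1,\vec m-\vec{\mathfrak t}_1}B_{\vec n,\vec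 m}\,\mathrm dw}{\int_\Delta A_{\vec n+\vec{\mathfrak s}_1,\vec m-\vec{\mathfrak t}_1}B_{\vec n,\vec m}\,\mathrm dw},$$ $$b^{-i}_{\vec n,\vec m}=\frac{\int_\Delta x\,A_{\vec n-\vec s_{i-1},\vec m-\vec{\mathfrak t}_{i+1}}B_{\vec n,\vec m}\,\mathrm dw}{\int_\Delta A_{\vec n-\vec s_{i-1},\vec m-\vec{\mathfrak t}_{i+1}}B_{\vec n-\vec s_i,\vec m-\vec{\mathfrak t}_i}\,\mathrm dw}\ (1\le i\le p).$$ (I) If $|\vec n|=|\vec m|+1$, then $$xA_{\vec n,\vec m}(x)=\sum_{j=1}^q a^{-j}_{\vec n,\vec m}A_{\vec n-\vec{\mathfrak s}_j,\vec m-\vec t_j}(x)+a^0_{\vec n,\vec m}A_{\vec n,\vec m}(x)+\sum_{i=1}^p a^{i}_{\vec n,\vec m}A_{\vec n+\vec s_i,\vec m+\vec{\mathfrak t}_i}(x),$$ where, with the $b$'s at shifted indices given by the quotient formulas of (II) for those indices, $$a^{-j}_{\vec n,\vec m}=b^j_{\vec n-\vec{\mathfrak s}_{j+1},\vec m-\vec t_{j-1}}\,\frac{\int_\Delta B_{\vec n-\vec{\mathfrak s}_{j+1}+\vec{\mathfrak s}_j,\vec m-\vec t_{j-1}+\vec t_j}A_{\vec n,\vec m}\,\mathrm dw}{\int_\Delta B_{\vec n-\vec{\mathfrak s}_{j+1},\vec m-\vec t_{j-1}}A_{\vec n-\vec{\mathfrak s}_j,\vec m-\vec t_j}\,\mathrm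 dw}\ (1\le j\le q),\qquad a^0_{\vec n,\vec m}=b^0_{\vec n-\vec{\mathfrak s}_1,\vec m+\vec{\mathfrak t}_1},$$ $$a^{i}_{\vec n,\vec m}=b^{-i}_{\vec n+\vec s_{i-1},\vec m+\vec{\mathfrak t}_{i+1}}\,\frac{\int_\Delta B_{\vec n-\vec s_i+\vec s_{i-1},\vec m-\vec{\mathfrak t}_i+\vec{\mathfrak t}_{i+1}}A_{\vec n,\vec m}\,\mathrm dw}{\int_\Delta B_{\vec n+\vec s_{i-1},\vec m+\vec{\mathfrak t}_{i+1}}A_{\vec n+\vec s_i,\vec m+\vec{\mathfrak t}_i}\,\mathrm dw}\ (1\le i\le p).$$
   Context: $\Delta\subseteq\mathbb R$ is an interval, $\mathrm dw$ a positive Borel measure on $\Delta$, $u_1,\ldots,u_p,v_1,\ldots,v_q:\Delta\to\mathbb R_+$ positive measurable weights with $\int_\Delta|x|^ru_iv_j\,\mathrm dw<\infty$ for all $r\in\mathbb N_0$ and all $i,j$. $|\cdot|$ is the sum of components of a multi-index. Type-I form ($\vec n\in\mathbb N_0^p$, $\vec m\in\mathbb N_0^q$, $|\vec n|=|\vec m|+1$): a nonzero $A_{\vec n,\vec m}=\sum_{i=1}^pA^{(i)}_{\vec n,\vec m}u_i$, with polynomials $\deg A^{(i)}\le n_i-1$ ($A^{(i)}\equiv0$ if $n_i=0$) and $\int_\Delta x^kA_{\vec n,\vec m}v_j\,\mathrm dw=0$ for $0\le k\le m_j-1$, $1\le j\le q$. Type-II form ($|\vec m|=|\vec n|+1$):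 a nonzero $B_{\vec n,\vec m}=\sum_{j=1}^qB^{(j)}_{\vec n,\vec m}v_j$, with polynomials $\deg B^{(j)}\le m_j-1$ ($B^{(j)}\equiv0$ if $m_j=0$) and $\int_\Delta x^kB_{\vec n,\vec m}u_i\,\mathrm dw=0$ for $0\le k\le n_i-1$, $1\le i\le p$. AT system: for every multi-index $\vec k$, the functions $x^\ell u_i$, $0\le\ell\le k_i-1$, $1\le i\le p$, form a Chebyshev system on $\Delta$ (similarly for $v$). Standing fact used by the paper: if $u$ and $v$ are AT systems on $\Delta$, every admissible multi-index (every pair with $|\vec n|=|\vec m|\pm1$) is normal, i.e. the corresponding form is unique up to a nonzero factor and every component with positive upper index has maximal degree ($\deg A^{(i)}=n_i-1$ if $n_i>0$, $\deg B^{(j)}=m_j-1$ if $m_j>0$). Paths: $\vec 1_d$ is the all-ones vector, $\vec e_k$ the $k$-th unit vector; for $r\in\mathbb N_0$, $\vec s_{rp+i}=r\vec 1_p+\sum_{k=1}^i\vec e_{\pi_s(k)}$, $\vec{\mathfrak s}_{rp+i}=r\vec 1_p+\sum_{k=1}^i\vec e_{\pi_{\mathfrak s}(k)}$ ($0\le i\le p-1$), $\vec t_{rq+j}=r\vec 1_q+\sum_{k=1}^j\vec e_{\pi_t(k)}$, $\vec{\mathfrak t}_{rq+j}=r\vec 1_q+\sum_{k=1}^j\vec e_{\pi_{\mathfrak t}(k)}$ ($0\le j\le q-1$). *)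

theory Defs
  imports
    "HOL-Analysis.Analysis"
    "HOL-Computational_Algebra.Polynomial"
    "HOL-Combinatorics.Permutations"
    "HOL-Library.Function_Algebras"
begin

text \<open>
  Multi-indices of length \<open>d\<close> are functions \<open>nat \<Rightarrow> int\<close> with entries at the positions
  \<open>1, \<dots>, d\<close>, extended by \<open>0\<close>. Entries are integers so that differences of multi-indices
  do not truncate; sums, differences and \<open>\<le>\<close> are pointwise.
\<close>

type_synonym mindex = "nat \<Rightarrow> int"

definition multi_index :: "nat \<Rightarrow> mindex \<Rightarrow> bool" where
  "multi_index d k \<longleftrightarrow> 0 \<le> k \<and> (\<forall>i. i \<notin> {1..d} \<longrightarrow> k i = 0)"

definition msize :: "nat \<Rightarrow> mindex \<Rightarrow> int" where
  "msize d k = (\<Sum>i=1..d. k i)"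

definition mones :: "nat \<Rightarrow> mindex" where
  "mones d = (\<lambda>i. if i \<in> {1..d} then 1 else 0)"

definition munit :: "nat \<Rightarrow> mindex" where
  "munit k = (\<lambda>i. if i = k then 1 else 0)"

text \<open>Here \<open>k = r d + l\<close> with \<open>r = k div d\<close> and \<open>0 \<le> l = k mod d \<le> d - 1\<close>.\<close>

definition mpath :: "nat \<Rightarrow> (nat \<Rightarrow> nat) \<Rightarrow> nat \<Rightarrow> mindex" where
  "mpath d \<pi> k = (\<lambda>i. int (k div d) * mones d i + (\<Sum>l=1..k mod d. munit (\<pi> l) i))"

text \<open>As usual, a Chebyshev system consists of continuous functions.\<close>

definition chebyshev_system :: "real set \<Rightarrow> 'a set \<Rightarrow> ('a \<Rightarrow> real \<Rightarrow> real) \<Rightarrow> bool" where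
  "chebyshev_system \<Delta> I \<phi> \<longleftrightarrow>
     finite I \<and> (\<forall>i\<in>I. continuous_on \<Delta> (\<phi> i)) \<and>
     (\<forall>c. (\<exists>i\<in>I. c i \<noteq> 0) \<longrightarrow>
        finite {x \<in> \<Delta>. (\<Sum>i\<in>I. c i * \<phi> i x) = 0} \<and>
        card {x \<in> \<Delta>. (\<Sum>i\<in>I. c i * \<phi> i x) = 0} \<le> card I - 1)"

definition AT_system :: "real set \<Rightarrow> nat \<Rightarrow> (nat \<Rightarrow> real \<Rightarrow> real) \<Rightarrow> bool" where
  "AT_system \<Delta> p u \<longleftrightarrow>
     (\<forall>k. multi_index p k \<longrightarrow>
        chebyshev_system \<Delta> {(i, l). i \<in> {1..p} \<and> int l \<le> k i - 1} (\<lambda>(i, l) x. x ^ l * u i x))"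

text \<open>
  \<open>mixed_form w p u n q v m F\<close>: \<open>F\<close> is a nonzero combination of the \<open>u\<^sub>i\<close> with polynomial
  coefficients of degrees at most \<open>n\<^sub>i - 1\<close>, orthogonal to \<open>x\<^sup>k v\<^sub>j\<close> for \<open>k \<le> m\<^sub>j - 1\<close>. The set
  \<open>\<Delta>\<close> is the space of the measure \<open>w\<close>; values of \<open>F\<close> outside of it are irrelevant.
  Type II is type I with the roles of \<open>(u, n)\<close> and \<open>(v, m)\<close> exchanged.
\<close>

definition mixed_form ::
  "real measure \<Rightarrow> nat \<Rightarrow> (nat \<Rightarrow> real \<Rightarrow> real) \<Rightarrow> mindex \<Rightarrow>
   nat \<Rightarrow> (nat \<Rightarrow> real \<Rightarrow> real) \<Rightarrow> mindex \<Rightarrow> (real \<Rightarrow> real) \<Rightarrow> bool" where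
  "mixed_form w p u n q v m F \<longleftrightarrow>
     (\<exists>P :: nat \<Rightarrow> real poly.
        (\<forall>i\<in>{1..p}. if n i = 0 then P i = 0 else int (degree (P i)) \<le> n i - 1) \<and>
        (\<forall>x\<in>space w. F x = (\<Sum>i=1..p. poly (P i) x * u i x))) \<and>
     (\<exists>x\<in>space w. F x \<noteq> 0) \<and>
     (\<forall>j\<in>{1..q}. \<forall>k::nat. int k \<le> m j - 1 \<longrightarrow> (LINT x|w. x ^ k * F x * v j x) = 0)"

definition type_I_form ::
  "real measure \<Rightarrow> nat \<Rightarrow> nat \<Rightarrow> (nat \<Rightarrow> real \<Rightarrow> real) \<Rightarrow> (nat \<Rightarrow> real \<Rightarrow> real) \<Rightarrow>
   mindex \<Rightarrow> mindex \<Rightarrow> (real \<Rightarrow> real) \<Rightarrow> bool" where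
  "type_I_form w p q u v n m F \<longleftrightarrow> mixed_form w p u n q v m F"

definition type_II_form ::
  "real measure \<Rightarrow> nat \<Rightarrow> nat \<Rightarrow> (nat \<Rightarrow> real \<Rightarrow> real) \<Rightarrow> (nat \<Rightarrow> real \<Rightarrow> real) \<Rightarrow>
   mindex \<Rightarrow> mindex \<Rightarrow> (real \<Rightarrow> real) \<Rightarrow> bool" where
  "type_II_form w p q u v n m F \<longleftrightarrow> mixed_form w q v m p u n F"

definition pairing :: "real measure \<Rightarrow> (real \<Rightarrow> real) \<Rightarrow> (real \<Rightarrow> real) \<Rightarrow> real" where
  "pairing w F G = (LINT x|w. F x * G x)"

text \<open>
  In the recurrence coefficients \<open>A\<close> and \<open>B\<close> are the chosen type I and type II forms,
  and \<open>s, \<ss>, t, \<tt>\<close> are paths of multi-indices.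
\<close>

type_synonym forms = "mindex \<Rightarrow> mindex \<Rightarrow> real \<Rightarrow> real"
type_synonym mpaths = "nat \<Rightarrow> mindex"

definition b_up :: "real measure \<Rightarrow> forms \<Rightarrow> forms \<Rightarrow> mpaths \<Rightarrow> mpaths \<Rightarrow>
    nat \<Rightarrow> mindex \<Rightarrow> mindex \<Rightarrow> real" where
  "b_up w A B \<ss> t j n m =
     pairing w (\<lambda>x. x * A (n + \<ss> (j + 1)) (m + t (j - 1)) x) (B n m) /
     pairing w (A (n + \<ss> (j + 1)) (m + t (j - 1))) (B (n + \<ss> j) (m + t j))"

definition b_zero :: "real measure \<Rightarrow> forms \<Rightarrow> forms \<Rightarrow> mpaths \<Rightarrow> mpaths \<Rightarrow>
    mindex \<Rightarrow> mindex \<Rightarrow> real" where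
  "b_zero w A B \<ss> \<tt> n m =
     pairing w (\<lambda>x. x * A (n + \<ss> 1) (m - \<tt> 1) x) (B n m) /
     pairing w (A (n + \<ss> 1) (m - \<tt> 1)) (B n m)"

definition b_down :: "real measure \<Rightarrow> forms \<Rightarrow> forms \<Rightarrow> mpaths \<Rightarrow> mpaths \<Rightarrow>
    nat \<Rightarrow> mindex \<Rightarrow> mindex \<Rightarrow> real" where
  "b_down w A B s \<tt> i n m =
     pairing w (\<lambda>x. x * A (n - s (i - 1)) (m - \<tt> (i + 1)) x) (B n m) /
     pairing w (A (n - s (i - 1)) (m - \<tt> (i + 1))) (B (n - s i) (m - \<tt> i))"

definition a_down :: "real measure \<Rightarrow> forms \<Rightarrow> forms \<Rightarrow> mpaths \<Rightarrow> mpaths \<Rightarrow>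
    nat \<Rightarrow> mindex \<Rightarrow> mindex \<Rightarrow> real" where
  "a_down w A B \<ss> t j n m =
     b_up w A B \<ss> t j (n - \<ss> (j + 1)) (m - t (j - 1)) *
     (pairing w (B (n - \<ss> (j + 1) + \<ss> j) (m - t (j - 1) + t j)) (A n m) /
      pairing w (B (n - \<ss> (j + 1)) (m - t (j - 1))) (A (n - \<ss> j) (m - t j)))"

definition a_zero :: "real measure \<Rightarrow> forms \<Rightarrow> forms \<Rightarrow> mpaths \<Rightarrow> mpaths \<Rightarrow>
    mindex \<Rightarrow> mindex \<Rightarrow> real" where
  "a_zero w A B \<ss> \<tt> n m = b_zero w A B \<ss> \<tt> (n - \<ss> 1) (m + \<tt> 1)"

definition a_up :: "real measure \<Rightarrow> forms \<Rightarrow> forms \<Rightarrow> mpaths \<Rightarrow> mpaths \<Rightarrow>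
    nat \<Rightarrow> mindex \<Rightarrow> mindex \<Rightarrow> real" where
  "a_up w A B s \<tt> i n m =
     b_down w A B s \<tt> i (n + s (i - 1)) (m + \<tt> (i + 1)) *
     (pairing w (B (n - s i + s (i - 1)) (m - \<tt> i + \<tt> (i + 1))) (A n m) /
      pairing w (B (n + s (i - 1)) (m + \<tt> (i + 1))) (A (n + s i) (m + \<tt> i)))"

end

theory Submission
  imports Defs
begin

text \<open>
  If \<open>|n| = |m|\<close>, a combination of the \<open>x\<^sup>l u\<^sub>i\<close> of index \<open>n\<close> that is orthogonal to all \<open>x\<^sup>k v\<^sub>j\<close> of index \<open>m\<close>
  vanishes, because the AT property of \<open>v\<close> supplies a combination of the \<open>x\<^sup>k v\<^sub>j\<close> with the same sign
  changes. All of the forms on the right-hand side of the recurrence lie on one chain \<open>(N\<^sub>k, M\<^sub>k)\<close> with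
  \<open>- p \<le> k \<le> q\<close>, running along \<open>s, \<tt>\<close> for \<open>k < 0\<close> and along \<open>\<ss>, t\<close> for \<open>k > 0\<close>; the type I forms in the
  coefficients are those at \<open>(N\<^bsub>k+1\<^esub>, M\<^bsub>k-1\<^esub>)\<close>, and they form the dual system. The recurrence for type I
  forms is the one for type II forms with \<open>u\<close> and \<open>v\<close> exchanged.
\<close>

section \<open>Sign changes in Chebyshev systems\<close>

text \<open>A Chebyshev system only bounds the number of zeros. It does not tell zeros with a sign
  change from zeros without one, and its functions are merely continuous, so derivatives cannot
  decide either. Sign changes are therefore extracted as a subset of the zeros, away from the end
  points of the interval. The range of the chain comes from multiplication by x: it costs one order
  of orthogonality against each of the p weights \<open>u i\<close> and one more degree for each of
  the q weights \<open>v j\<close>. A path needs p, respectively q, steps to add the all-ones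
  vector, so x times the form at 0 lies in the span at \<open>M q\<close> and is orthogonal at
  \<open>N (- p)\<close>. These sizes differ by p + q + 1, the number of members of the chain. The
  dual index \<open>(N (k + 1), M (k - 1))\<close> is dictated by triangularity: its orthogonality
  disposes of all earlier members, its span is annihilated by all later ones.\<close>

lemma homogeneous_system_nontrivial_solution:
  fixes f :: "'a \<Rightarrow> 'b \<Rightarrow> real"
  assumes "finite S" "finite I" "card S < card I"
  shows "\<exists>c. (\<exists>i\<in>I. c i \<noteq> 0) \<and> (\<forall>x\<in>S. (\<Sum>i\<in>I. c i * f i x) = 0)"
  using assms
proof (induction S arbitrary: I f rule: finite_induct)
  case empty
  then obtain i where "i \<in> I" by fastforce
  then show ?case by (intro exI[of _ "\<lambda>_. 1"]) auto
next
  case (insert x S)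
  show ?case
  proof (cases "\<forall>i\<in>I. f i x = 0")
    case True
    obtain c where "\<exists>i\<in>I. c i \<noteq> 0" "\<forall>y\<in>S. (\<Sum>i\<in>I. c i * f i y) = 0"
      using insert.IH[of I f] insert.prems insert.hyps by auto
    with True show ?thesis by (intro exI[of _ c]) auto
  next
    case False
    then obtain i0 where i0: "i0 \<in> I" "f i0 x \<noteq> 0" by blast
    \<comment> \<open>Gaussian elimination with pivot \<open>i0\<close>: every \<open>g i\<close>
      vanishes at \<open>x\<close>, so one unknown and one equation disappear together.\<close>
    define g where "g = (\<lambda>i y. f i y - f i x / f i0 x * f i0 y)"
    have "card S < card (I - {i0})"
      using insert.prems insert.hyps i0 by simp
    then obtain c where c: "\<exists>i\<in>I - {i0}. c i \<noteq> 0"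
        "\<forall>y\<in>S. (\<Sum>i\<in>I - {i0}. c i * g i y) = 0"
      using insert.IH[of "I - {i0}" g] insert.prems by auto
    \<comment> \<open>Back substitution: this value at \<open>i0\<close> turns the combination of
      the \<open>g i\<close> into one of the \<open>f i\<close> with the same values
      everywhere.\<close>
    define c' where "c' = c(i0 := - (\<Sum>i\<in>I - {i0}. c i * f i x) / f i0 x)"
    have expand: "(\<Sum>i\<in>I. c' i * f i y) = (\<Sum>i\<in>I - {i0}. c i * g i y)" for y
    proof -
      have "(\<Sum>i\<in>I. c' i * f i y) = c' i0 * f i0 y + (\<Sum>i\<in>I - {i0}. c' i * f i y)"
        using i0 insert.prems by (simp add: sum.remove)
      also have "(\<Sum>i\<in>I - {i0}. c' i * f i y) = (\<Sum>i\<in>I - {i0}. c i * f i y)"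
        by (intro sum.cong) (auto simp: c'_def)
      also have "c' i0 * f i0 y = (\<Sum>i\<in>I - {i0}. - (c i * (f i x / f i0 x * f i0 y)))"
        by (simp add: c'_def sum_negf sum_distrib_left sum_divide_distrib ac_simps)
      finally show ?thesis
        by (simp add: g_def right_diff_distrib sum.distrib sum_negf sum_subtractf)
    qed
    have "(\<Sum>i\<in>I - {i0}. c i * g i x) = 0"
      using i0 by (simp add: g_def)
    moreover have "\<exists>i\<in>I. c' i \<noteq> 0"
      using c(1) by (auto simp: c'_def)
    ultimately show ?thesis
      using c(2) expand by (intro exI[of _ c']) auto
  qed
qed

lemma nonvanishing_constant_sign:
  fixes f :: "real \<Rightarrow> real"
  assumes "is_interval J" "continuous_on J f" "\<And>x. x \<in> J \<Longrightarrow> f x \<noteq> 0"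
  shows "\<exists>d\<in>{1, -1}. \<forall>x\<in>J. d * f x > 0"
proof (rule ccontr)
  assume neg: "\<not> ?thesis"
  obtain x where x: "x \<in> J" "f x \<le> 0"
    using neg by (auto simp: not_less)
  obtain y where y: "y \<in> J" "f y \<ge> 0"
    using neg by (auto simp: not_less)
  have "is_interval (f ` J)"
    using assms connected_continuous_image is_interval_connected_1 by blast
  then have "0 \<in> f ` J"
    using x y by (auto intro: mem_is_interval_1_I[of "f ` J" "f x" "f y" 0])
  then show False using assms(3) by auto
qed

text \<open>\<open>S\<close> collects the zeros at which \<open>f\<close> changes sign; the product
  over \<open>S\<close> cancels these changes and leaves the single sign \<open>c\<close>. Points of
  \<open>J\<close> on both sides are demanded because an end point carries no sign change. The
  induction removes the largest zero \<open>z\<close>: to its right \<open>f\<close> has a fixed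
  sign \<open>d\<close>, which is compared with the sign \<open>c\<close> supplied by the hypothesis
  on the left.\<close>

lemma sign_pattern:
  fixes f :: "real \<Rightarrow> real"
  assumes "finite {x \<in> J. f x = 0}" "is_interval J" "continuous_on J f"
  shows "\<exists>S \<subseteq> {x \<in> J. f x = 0}. \<exists>c\<in>{1, -1}.
     (\<forall>s\<in>S. (\<exists>a\<in>J. a < s) \<and> (\<exists>b\<in>J. s < b)) \<and> (\<forall>x\<in>J. 0 \<le> c * f x * (\<Prod>s\<in>S. x - s))"
proof -
  define Z where "Z = {x \<in> J. f x = 0}"
  have "finite Z" using assms Z_def by simp
  then show ?thesis
    using Z_def assms(2,3)
  proof (induction Z arbitrary: J rule: finite_linorder_max_induct)
    case empty
    then have "\<exists>d\<in>{1, -1}. \<forall>x\<in>J. d * f x > 0"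
      by (intro nonvanishing_constant_sign) auto
    then obtain d where "d \<in> {1, -1}" "\<forall>x\<in>J. d * f x > 0" by blast

    then show ?case
      by (intro exI[of _ "{}"] conjI bexI[of _ d]) (auto intro: less_imp_le)
  next
    case (insert z Z)
    define J1 where "J1 = {x \<in> J. x < z}"
    define J2 where "J2 = {x \<in> J. z < x}"
    have zJ: "z \<in> J" "f z = 0" using insert.prems by auto
    have int: "is_interval J1" "is_interval J2"
      using insert.prems(2) unfolding is_interval_1 J1_def J2_def by (auto; fastforce)+
    have cont: "continuous_on J1 f" "continuous_on J2 f"
      using insert.prems(3) by (auto intro: continuous_on_subset simp: J1_def J2_def)
    have "\<And>x. x \<in> J2 \<Longrightarrow> f x \<noteq> 0"
      using insert.prems(1) insert.hyps(2) by (force simp: J2_def)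
    then obtain d where d: "d \<in> {1, -1}" "\<forall>x\<in>J2. d * f x > 0"
      using nonvanishing_constant_sign[of J2 f] int cont by blast
    have "Z = {x \<in> J1. f x = 0}"
      using insert.prems(1) insert.hyps(2) by (force simp: J1_def)
    from insert.IH[OF this int(1) cont(1)] obtain S c where
      S: "S \<subseteq> {x \<in> J1. f x = 0}" "c \<in> {1, -1}"
        "\<forall>s\<in>S. (\<exists>a\<in>J1. a < s) \<and> (\<exists>b\<in>J1. s < b)"
        "\<forall>x\<in>J1. 0 \<le> c * f x * (\<Prod>s\<in>S. x - s)"
      by blast
    have finS: "finite S"
      using S(1) \<open>Z = {x \<in> J1. f x = 0}\<close> insert.hyps(1) finite_subset by auto
    have split: "x \<in> J \<Longrightarrow> x \<in> J1 \<or> x = z \<or> x \<in> J2" for x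
      by (auto simp: J1_def J2_def)
    have pos: "(\<Prod>s\<in>S. x - s) > 0" if "x \<in> J2" for x
      using that S(1) by (intro prod_pos) (force simp: J1_def J2_def)
    have J1J: "J1 \<subseteq> J" and J2J: "J2 \<subseteq> J" by (auto simp: J1_def J2_def)
    show ?case
    proof (cases "J1 = {}")
      case True
      then have "0 \<le> d * f x * (\<Prod>s\<in>{}. x - s)" if "x \<in> J" for x
        using split[OF that] d zJ by (auto intro: less_imp_le)
      then show ?thesis using d(1) by (intro exI[of _ "{}"] conjI bexI[of _ d]) auto
    next
      case J1: False
      show ?thesis
      \<comment> \<open>To the right of \<open>S\<close> the product is positive, so
        \<open>c\<close> is the sign that persists across \<open>z\<close> unless a factor is added;
        none is due if \<open>d\<close> agrees or nothing lies beyond \<open>z\<close>.\<close>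
      proof (cases "J2 = {} \<or> d = c")
        case True
        have "0 \<le> c * f x * (\<Prod>s\<in>S. x - s)" if "x \<in> J" for x
          using split[OF that]
        proof (elim disjE)
          assume "x \<in> J2"
          then have "0 < c * f x" "0 < (\<Prod>s\<in>S. x - s)" using True d(2) pos by auto
          then show ?thesis by (simp add: less_imp_le)
        qed (use S(4) zJ in auto)
        moreover have "S \<subseteq> {x \<in> J. f x = 0}"
            "\<forall>s\<in>S. (\<exists>a\<in>J. a < s) \<and> (\<exists>b\<in>J. s < b)"
          using S(1,3) J1J by blast+
        ultimately show ?thesis using S(2)
          by (intro exI[of _ S] conjI bexI[of _ c]) simp_all
      next
        case False
        then have dc: "d = - c" using d(1) S(2) by auto
        have "z \<notin> S" using S(1) by (auto simp: J1_def)
        then have prod: "(\<Prod>s\<in>insert z S. x - s) = (x - z) * (\<Prod>s\<in>S. x - s)" for x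
          using finS by simp
        \<comment> \<open>The new factor \<open>x - z\<close> is negative on \<open>J1\<close> and
          positive on \<open>J2\<close>, so the overall sign becomes \<open>- c\<close>, which is
          \<open>d\<close>.\<close>
        have "0 \<le> - c * f x * (\<Prod>s\<in>insert z S. x - s)" if "x \<in> J" for x
          using split[OF that]
        proof (elim disjE)
          assume "x \<in> J1"
          then have "0 \<le> (z - x) * (c * f x * (\<Prod>s\<in>S. x - s))"
            using S(4) by (intro mult_nonneg_nonneg[of "z - x"]) (auto simp: J1_def)
          then show ?thesis unfolding prod by (simp add: algebra_simps)
        next
          assume x: "x \<in> J2"
          then have "0 < d * f x" "0 < x - z" using d(2) by (auto simp: J2_def)
          then have "0 \<le> (d * f x) * ((x - z) * (\<Prod>s\<in>S. x - s))"
            using pos[OF x] by (intro mult_nonneg_nonneg[of "d * f x"] mult_nonneg_nonneg[of "x - z"]) auto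
          then show ?thesis unfolding prod using dc by (simp add: mult.assoc)
        qed (use zJ in auto)
        moreover have "(\<exists>a\<in>J. a < z) \<and> (\<exists>b\<in>J. z < b)"
          using J1 False by (auto simp: J1_def J2_def)
        moreover have "insert z S \<subseteq> {x \<in> J. f x = 0}"
          using S(1) zJ J1J by auto
        moreover have "- c \<in> {1, -1}" using S(2) by auto
        moreover have "\<forall>s\<in>S. (\<exists>a\<in>J. a < s) \<and> (\<exists>b\<in>J. s < b)"
          using S(3) J1J by blast
        ultimately show ?thesis
          by (intro exI[of _ "insert z S"] conjI bexI[of _ "- c"]) simp_all
      qed
    qed
  qed
qed

text \<open>If the combination vanishing on \<open>S\<close> did not change sign at some \<open>s \<in> S\<close>, adding a small multiple
  of a combination vanishing on \<open>S - {s}\<close> but not at \<open>s\<close> would split \<open>s\<close> into two zeros.\<close>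

lemma chebyshev_prescribed_sign_changes:
  assumes cheb: "chebyshev_system J I \<phi>" and int: "is_interval J" and inf: "infinite J"
    and S: "finite S" "S \<subseteq> J" "card I = card S + 1"
    and inner: "\<And>s. s \<in> S \<Longrightarrow> (\<exists>a\<in>J. a < s) \<and> (\<exists>b\<in>J. s < b)"
  shows "\<exists>g. \<exists>\<sigma>\<in>{1, -1::real}. (\<exists>i\<in>I. g i \<noteq> 0) \<and>
    (\<forall>x\<in>J. 0 \<le> \<sigma> * (\<Sum>i\<in>I. g i * \<phi> i x) * (\<Prod>s\<in>S. x - s))"
proof -
  have finI: "finite I" and cont: "\<And>i. i \<in> I \<Longrightarrow> continuous_on J (\<phi> i)"
    using cheb by (auto simp: chebyshev_system_def)
  have zeros: "finite {x \<in> J. (\<Sum>i\<in>I. c i * \<phi> i x) = 0}"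
      "card {x \<in> J. (\<Sum>i\<in>I. c i * \<phi> i x) = 0} \<le> card S" if "\<exists>i\<in>I. c i \<noteq> 0" for c
    using cheb that S(3) by (auto simp: chebyshev_system_def)
  have toomany: False if "\<exists>i\<in>I. c i \<noteq> 0" "T \<subseteq> {x \<in> J. (\<Sum>i\<in>I. c i * \<phi> i x) = 0}" "card T > card S"
    for c T
    using zeros[OF that(1)] card_mono[OF _ that(2)] that(3) by linarith
  obtain g where g: "\<exists>i\<in>I. g i \<noteq> 0" "\<forall>x\<in>S. (\<Sum>i\<in>I. g i * \<phi> i x) = 0"
    using homogeneous_system_nontrivial_solution[of S I \<phi>] S finI by auto
  define G where "G = (\<lambda>x. \<Sum>i\<in>I. g i * \<phi> i x)"
  have Gz: "{x \<in> J. G x = 0} = S"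
  proof -
    have "S \<subseteq> {x \<in> J. G x = 0}" using g S by (auto simp: G_def)
    then show ?thesis
      using zeros[OF g(1)] card_seteq unfolding G_def by metis
  qed
  have contG: "continuous_on J G"
    unfolding G_def using cont by (intro continuous_intros) auto
  obtain S0 \<sigma> where S0: "S0 \<subseteq> S" "\<sigma> \<in> {1, -1}" "\<forall>x\<in>J. 0 \<le> \<sigma> * G x * (\<Prod>s\<in>S0. x - s)"
    using sign_pattern[of J G] S int contG unfolding Gz by blast
  have "S0 = S"
  proof (rule ccontr)
    assume "S0 \<noteq> S"
    then obtain s where s: "s \<in> S" "s \<notin> S0" using S0 by blast
    \<comment> \<open>With the spare node \<open>z\<close>, \<open>h\<close> has as many prescribed
      zeros as \<open>S\<close> has points, none of them \<open>s\<close>; a zero at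
      \<open>s\<close> would be one too many. Without \<open>z\<close> nothing would exclude
      \<open>h = g\<close>, which vanishes at \<open>s\<close>.\<close>
    obtain z where z: "z \<in> J" "z \<notin> S" using inf S(1) finite_subset[of J S] by auto
    have "card (insert z (S - {s})) < card I"
      using S s z card_gt_0_iff[of S] by auto
    then obtain h where h: "\<exists>i\<in>I. h i \<noteq> 0" "\<forall>x\<in>insert z (S - {s}). (\<Sum>i\<in>I. h i * \<phi> i x) = 0"
      using homogeneous_system_nontrivial_solution[of "insert z (S - {s})" I \<phi>] S finI by blast
    define H where "H = (\<lambda>x. \<Sum>i\<in>I. h i * \<phi> i x)"
    have Hs: "H s \<noteq> 0"
    proof
      assume "H s = 0"
      then have "insert z S \<subseteq> {x \<in> J. (\<Sum>i\<in>I. h i * \<phi> i x) = 0}"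
        using h z S by (auto simp: H_def)
      moreover have "card (insert z S) > card S" using S z by simp
      ultimately show False using toomany[OF h(1)] by blast
    qed
    have contH: "continuous_on J H"
      unfolding H_def using cont by (intro continuous_intros) auto
    obtain a0 b0 where ab0: "a0 \<in> J" "a0 < s" "b0 \<in> J" "s < b0" using inner[OF s(1)] by blast
    \<comment> \<open>\<open>a\<close> and \<open>b\<close> bracket \<open>s\<close> with no other
      point of \<open>S\<close> strictly between them; the halfway points \<open>l\<close> and
      \<open>r\<close> then bound a closed interval that meets \<open>S\<close> in \<open>s\<close>
      alone.\<close>
    define a where "a = Max (insert a0 {x\<in>S. x < s})"
    define b where "b = Min (insert b0 {x\<in>S. s < x})"
    have a: "a < s" "a0 \<le> a" "\<And>x. x \<in> S \<Longrightarrow> x < s \<Longrightarrow> x \<le> a"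
      unfolding a_def using S ab0 by auto
    have b: "s < b" "b \<le> b0" "\<And>x. x \<in> S \<Longrightarrow> s < x \<Longrightarrow> b \<le> x"
      unfolding b_def using S ab0 by auto
    define l where "l = (a + s) / 2"
    define r where "r = (s + b) / 2"
    have lr: "a < l" "l < s" "s < r" "r < b" using a b by (auto simp: l_def r_def)
    have sub: "{l..r} \<subseteq> J"
    proof
      fix x assume "x \<in> {l..r}"
      then show "x \<in> J" using int ab0 lr a(2) b(2) by (auto intro: mem_is_interval_1_I[of J a0 b0 x])
    qed
    have lrJ: "l \<in> J" "r \<in> J" using sub lr by auto
    have noS: "x \<notin> S" if "l \<le> x" "x \<le> r" "x \<noteq> s" for x
      using that lr a(3)[of x] b(3)[of x] by (cases "x < s") force+
    have prodne: "(\<Prod>y\<in>S0. x - y) \<noteq> 0" if "x \<in> {l..r}" for x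
    proof -
      have "x \<notin> S0" using that noS[of x] s S0 by force
      then show ?thesis using finite_subset[OF S0(1) S(1)] by auto
    qed
    have "\<exists>d\<in>{1, -1}. \<forall>x\<in>{l..r}. d * (\<Prod>y\<in>S0. x - y) > 0"
      using prodne by (intro nonvanishing_constant_sign continuous_intros is_interval_cc) auto
    then obtain d where d: "d \<in> {1, -1}" "\<And>x. x \<in> {l..r} \<Longrightarrow> d * (\<Prod>y\<in>S0. x - y) > 0" by blast
    \<comment> \<open>As \<open>s\<close> is not in \<open>S0\<close>, the product over
      \<open>S0\<close> keeps the sign \<open>d\<close> near \<open>s\<close>, so
      \<open>\<tau> * G\<close> is positive on both sides of \<open>s\<close>: the supposed touching
      zero.\<close>
    define \<tau> where "\<tau> = \<sigma> * d"
    have \<tau>: "\<tau> \<in> {1, -1}" using S0(2) d(1) by (auto simp: \<tau>_def)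
    have Gsgn: "\<tau> * G x > 0" if "x \<in> {l..r}" "x \<noteq> s" for x
    proof -
      have "0 \<le> \<sigma> * G x * (\<Prod>y\<in>S0. x - y)" using S0(3) sub that by blast
      then have "0 \<le> (d * d) * (\<sigma> * G x * (\<Prod>y\<in>S0. x - y))" using d(1) by auto
      then have "0 \<le> (\<tau> * G x) * (d * (\<Prod>y\<in>S0. x - y))"
        by (simp add: \<tau>_def ac_simps)
      then have "0 \<le> \<tau> * G x" using d(2)[OF that(1)] by (simp add: zero_le_mult_iff)
      moreover have "G x \<noteq> 0"
        using Gz noS[of x] that sub by auto
      ultimately show ?thesis using \<tau> by (cases "G x > 0") auto
    qed
    \<comment> \<open>Division by \<open>H s\<close> gives the perturbation the value
      \<open>e\<close> at \<open>s\<close>, where it beats \<open>G s = 0\<close>. The summand 1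
      makes \<open>2 * M\<close> strictly larger than both ratios, so at \<open>l\<close> and
      \<open>r\<close> the perturbation stays below \<open>\<tau> * G\<close>.\<close>
    define M where "M = 1 + \<bar>H l / H s\<bar> + \<bar>H r / H s\<bar>"
    define e where "e = min (\<tau> * G l) (\<tau> * G r) / (2 * M)"
    have M: "M > 0" "\<bar>H l / H s\<bar> < 2 * M" "\<bar>H r / H s\<bar> < 2 * M"
    proof -
      have "a < 2 * (1 + a + b)" "b < 2 * (1 + a + b)" if "0 \<le> a" "0 \<le> b" for a b :: real
        using that by auto
      then show "\<bar>H l / H s\<bar> < 2 * M" "\<bar>H r / H s\<bar> < 2 * M"
        unfolding M_def by (meson abs_ge_zero)+
    qed (simp add: M_def add_pos_nonneg)
    have GLR: "\<tau> * G l > 0" "\<tau> * G r > 0" using Gsgn[of l] Gsgn[of r] lr by auto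
    have e: "e > 0" using M GLR by (simp add: e_def)
    have e2: "e * (2 * M) = min (\<tau> * G l) (\<tau> * G r)" using M by (simp add: e_def)
    define K where "K = (\<lambda>x. \<tau> * G x - e / H s * H x)"
    have Ks: "K s < 0" using Gz s e Hs by (auto simp: K_def)
    have small: "e / H s * H x < min (\<tau> * G l) (\<tau> * G r)" if "\<bar>H x / H s\<bar> < 2 * M" for x
    proof -
      have "e / H s * H x = e * (H x / H s)" by simp
      also have "\<dots> \<le> e * \<bar>H x / H s\<bar>" using e by (intro mult_left_mono abs_ge_self) simp
      also have "\<dots> < e * (2 * M)" using that e by (rule mult_strict_left_mono)
      finally show ?thesis using e2 by simp
    qed
    have Klr: "K l > 0" "K r > 0" using small[OF M(2)] small[OF M(3)] by (auto simp: K_def)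
    have contK: "continuous_on {l..r} K"
      unfolding K_def
      by (rule continuous_on_subset[OF _ sub]) (intro continuous_intros contG contH)
    obtain y1 where y1: "l \<le> y1" "y1 \<le> s" "K y1 = 0"
      using IVT2'[of K s 0 l] Ks Klr lr contK continuous_on_subset[OF contK, of "{l..s}"] by auto
    obtain y2 where y2: "s \<le> y2" "y2 \<le> r" "K y2 = 0"
      using IVT'[of K s 0 r] Ks Klr lr continuous_on_subset[OF contK, of "{s..r}"] by auto
    have ne: "y1 \<noteq> s" "y2 \<noteq> s" using y1 y2 Ks by auto
    have Kexp: "K x = (\<Sum>i\<in>I. (\<tau> * g i - e / H s * h i) * \<phi> i x)" for x
      by (simp add: K_def G_def H_def left_diff_distrib sum_subtractf sum_distrib_left mult.assoc)
    have nz: "\<exists>i\<in>I. \<tau> * g i - e / H s * h i \<noteq> 0"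
    proof (rule ccontr)
      assume "\<not> ?thesis"
      then have "K s = 0" unfolding Kexp by (intro sum.neutral) auto
      then show False using Ks by simp
    qed
    have "insert y1 (insert y2 (S - {s})) \<subseteq> {x \<in> J. K x = 0}"
    proof -
      have "K x = 0" if "x \<in> S - {s}" for x
        using that Gz h by (auto simp: K_def H_def)
      then show ?thesis using y1 y2 sub lr S by auto
    qed
    moreover have "card (insert y1 (insert y2 (S - {s}))) > card S"
    proof -
      have "y1 \<notin> S" "y2 \<notin> S" using noS[of y1] noS[of y2] y1 y2 ne lr by auto
      moreover have "y1 \<noteq> y2" using y1 y2 ne by auto
      ultimately show ?thesis using S s card_gt_0_iff[of S] by auto
    qed
    ultimately show False using toomany[OF nz] unfolding Kexp by blast
  qed
  then have "\<forall>x\<in>J. 0 \<le> \<sigma> * G x * (\<Prod>s\<in>S. x - s)" using S0(3) by simp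
  with S0(2) g(1) show ?thesis
    unfolding G_def by (intro exI[of _ g] bexI[of _ \<sigma>] conjI)
qed

section \<open>Weighted polynomials and normality\<close>

definition idx :: "nat \<Rightarrow> mindex \<Rightarrow> (nat \<times> nat) set" where
  "idx d k = {(i, l). i \<in> {1..d} \<and> int l \<le> k i - 1}"

definition wmono :: "(nat \<Rightarrow> real \<Rightarrow> real) \<Rightarrow> nat \<times> nat \<Rightarrow> real \<Rightarrow> real" where
  "wmono u = (\<lambda>(i, l) x. x ^ l * u i x)"

text \<open>Coefficients over the finite set \<open>idx\<close> in place of polynomials make a form
  literally a combination of a Chebyshev system. Only values on \<open>J\<close> count, as forms are
  determined only on the space of the measure.\<close>

definition in_span :: "real set \<Rightarrow> nat \<Rightarrow> (nat \<Rightarrow> real \<Rightarrow> real) \<Rightarrow> mindex \<Rightarrow> (real \<Rightarrow> real) \<Rightarrow> bool" where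
  "in_span J d u k F \<longleftrightarrow> (\<exists>c. \<forall>x\<in>J. F x = (\<Sum>a\<in>idx d k. c a * wmono u a x))"

definition orth :: "real measure \<Rightarrow> nat \<Rightarrow> (nat \<Rightarrow> real \<Rightarrow> real) \<Rightarrow> mindex \<Rightarrow> (real \<Rightarrow> real) \<Rightarrow> bool" where
  "orth w d u k F \<longleftrightarrow> (\<forall>a\<in>idx d k. pairing w F (wmono u a) = 0)"

lemma idx_eq_Sigma: "idx d k = (SIGMA i:{1..d}. {..<nat (k i)})"
  by (auto simp: idx_def)

lemma finite_idx [simp]: "finite (idx d k)"
  by (simp add: idx_eq_Sigma)

lemma card_idx: "multi_index d k \<Longrightarrow> int (card (idx d k)) = msize d k"
  by (simp add: idx_eq_Sigma msize_def multi_index_def le_fun_def)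

lemma idx_mono: "k \<le> k' \<Longrightarrow> idx d k \<subseteq> idx d k'"
  by (auto simp: idx_def le_fun_def intro: less_le_trans)

text \<open>Exponents in component \<open>e\<close> run from 0 to \<open>k e - 1\<close>, so a unit
  step adds the single function with exponent \<open>k e\<close>.\<close>

lemma idx_add_munit:
  assumes "multi_index d k" "e \<in> {1..d}"
  shows "idx d (k + munit e) = insert (e, nat (k e)) (idx d k)" "(e, nat (k e)) \<notin> idx d k"
  using assms by (auto simp: idx_def munit_def multi_index_def le_fun_def split: if_splits)

lemma msize_add_munit: "e \<in> {1..d} \<Longrightarrow> msize d (k + munit e) = msize d k + 1"
  by (simp add: msize_def munit_def sum.distrib)

lemma AT_systemD:
  "AT_system J d u \<Longrightarrow> multi_index d k \<Longrightarrow> chebyshev_system J (idx d k) (wmono u)"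
  by (simp add: AT_system_def idx_def wmono_def)

text \<open>To imitate few sign changes, a Chebyshev system with exactly one function more is
  required, and the AT property speaks only of index sets of multi-indices. Units are removed from a
  component that is still positive.\<close>

lemma exists_smaller_multi_index:
  assumes "multi_index d k" "c \<le> card (idx d k)"
  shows "\<exists>k'. multi_index d k' \<and> k' \<le> k \<and> card (idx d k') = c"
  using assms
proof (induction "card (idx d k) - c" arbitrary: k)
  case 0
  then show ?case by auto
next
  case (Suc r)
  then have "idx d k \<noteq> {}" by auto
  then obtain e l where e: "e \<in> {1..d}" "int l \<le> k e - 1" by (auto simp: idx_def)
  define k1 where "k1 = k - munit e"
  have k1: "multi_index d k1" "k1 \<le> k" "k = k1 + munit e"
    using Suc.prems(1) e by (auto simp: k1_def multi_index_def munit_def le_fun_def)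
  have "card (idx d k) = Suc (card (idx d k1))"
    using idx_add_munit[OF k1(1) e(1)] k1(3) by simp
  then have "r = card (idx d k1) - c" "c \<le> card (idx d k1)"
    using Suc.hyps(2) by auto
  then obtain k' where "multi_index d k'" "k' \<le> k1" "card (idx d k') = c"
    using Suc.hyps(1)[of k1] k1(1) by blast
  then show ?case using k1(2) order_trans by blast
qed

lemma in_span_eqI:
  "in_span J d u k G \<Longrightarrow> (\<And>x. x \<in> J \<Longrightarrow> F x = G x) \<Longrightarrow> in_span J d u k F"
  by (simp add: in_span_def)

lemma in_span_zero: "in_span J d u k (\<lambda>x. 0)"
  unfolding in_span_def by (intro exI[of _ "\<lambda>_. 0"]) auto

lemma in_span_wmono:
  assumes "a \<in> idx d k"
  shows "in_span J d u k (wmono u a)"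
proof -
  have "wmono u a x = (\<Sum>b\<in>idx d k. (if b = a then 1 else 0) * wmono u b x)" for x
    using assms by (subst sum.remove[of _ a]) auto
  then show ?thesis unfolding in_span_def by (intro exI[of _ "\<lambda>b. if b = a then 1 else 0"]) simp
qed

lemma in_span_sum:
  assumes "\<And>i. i \<in> K \<Longrightarrow> in_span J d u k (G i)"
  shows "in_span J d u k (\<lambda>x. \<Sum>i\<in>K. c i * G i x)"
proof -
  obtain C where C: "\<And>i x. i \<in> K \<Longrightarrow> x \<in> J \<Longrightarrow> G i x = (\<Sum>a\<in>idx d k. C i a * wmono u a x)"
    using assms unfolding in_span_def by metis
  have "(\<Sum>i\<in>K. c i * G i x) = (\<Sum>a\<in>idx d k. (\<Sum>i\<in>K. c i * C i a) * wmono u a x)" if "x \<in> J" for x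
  proof -
    have "(\<Sum>i\<in>K. c i * G i x) = (\<Sum>i\<in>K. \<Sum>a\<in>idx d k. c i * C i a * wmono u a x)"
      using C that by (simp add: sum_distrib_left mult.assoc)
    also have "\<dots> = (\<Sum>a\<in>idx d k. \<Sum>i\<in>K. c i * C i a * wmono u a x)"
      by (rule sum.swap)
    finally show ?thesis by (simp add: sum_distrib_right)
  qed
  then show ?thesis unfolding in_span_def by (intro exI[of _ "\<lambda>a. \<Sum>i\<in>K. c i * C i a"]) blast
qed

lemma in_span_diff:
  assumes "in_span J d u k F" "in_span J d u k G"
  shows "in_span J d u k (\<lambda>x. F x - G x)"
  using in_span_sum[of "{True, False}" J d u k "\<lambda>b. if b then F else G" "\<lambda>b. if b then 1 else -1"] assms
  by simp

lemma in_span_mono: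
  assumes "in_span J d u k F" "k \<le> k'"
  shows "in_span J d u k' F"
proof -
  obtain c where c: "\<And>x. x \<in> J \<Longrightarrow> F x = (\<Sum>a\<in>idx d k. c a * wmono u a x)"
    using assms by (auto simp: in_span_def)
  have "in_span J d u k' (\<lambda>x. \<Sum>a\<in>idx d k. c a * wmono u a x)"
    using idx_mono[OF assms(2)] by (intro in_span_sum in_span_wmono) auto
  then show ?thesis using c by (rule in_span_eqI)
qed

lemma in_span_times_x:
  assumes "in_span J d u k F"
  shows "in_span J d u (k + mones d) (\<lambda>x. x * F x)"
proof -
  obtain c where c: "\<And>x. x \<in> J \<Longrightarrow> F x = (\<Sum>a\<in>idx d k. c a * wmono u a x)"
    using assms by (auto simp: in_span_def)
  have "in_span J d u (k + mones d) (\<lambda>x. \<Sum>a\<in>idx d k. c a * wmono u (fst a, Suc (snd a)) x)"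
    by (intro in_span_sum in_span_wmono) (auto simp: idx_def mones_def)
  moreover have "x * F x = (\<Sum>a\<in>idx d k. c a * wmono u (fst a, Suc (snd a)) x)" if "x \<in> J" for x
    using c[OF that] by (simp add: sum_distrib_left wmono_def case_prod_unfold ac_simps)
  ultimately show ?thesis by (rule in_span_eqI)
qed

text \<open>Under the integral the factor x moves to the test function and raises its exponent by
  one. Entries of \<open>k - mones d\<close> may be negative; they impose no condition.\<close>

lemma orth_times_x:
  assumes "orth w d u k F"
  shows "orth w d u (k - mones d) (\<lambda>x. x * F x)"
  unfolding orth_def
proof
  fix a assume a: "a \<in> idx d (k - mones d)"
  then have "(fst a, Suc (snd a)) \<in> idx d k" by (auto simp: idx_def mones_def)
  then have "pairing w F (wmono u (fst a, Suc (snd a))) = 0"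
    using assms by (auto simp: orth_def)
  then show "pairing w (\<lambda>x. x * F x) (wmono u a) = 0"
    by (simp add: pairing_def wmono_def case_prod_unfold ac_simps)
qed

lemma orth_antimono: "orth w d u k' F \<Longrightarrow> k \<le> k' \<Longrightarrow> orth w d u k F"
  using idx_mono[of k k' d] by (auto simp: orth_def)

lemma mixed_formD:
  assumes "mixed_form w p u n q v m F"
  shows "in_span (space w) p u n F" "orth w q v m F" "\<exists>x\<in>space w. F x \<noteq> 0"
proof -
  \<comment> \<open>The factor 1 gives the sum the shape \<open>c i * G i x\<close> of
    \<open>in_span_sum\<close>.\<close>
  obtain P :: "nat \<Rightarrow> real poly" where
    P: "\<And>i. i \<in> {1..p} \<Longrightarrow> if n i = 0 then P i = 0 else int (degree (P i)) \<le> n i - 1"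
      "\<And>x. x \<in> space w \<Longrightarrow> F x = (\<Sum>i=1..p. 1 * (poly (P i) x * u i x))"
    using assms unfolding mixed_form_def mult_1 by blast
  have "in_span (space w) p u n (\<lambda>x. poly (P i) x * u i x)" if i: "i \<in> {1..p}" for i
  \<comment> \<open>The zero polynomial has degree 0, which exceeds \<open>n i - 1\<close> here, so
    this case cannot pass through the degree bound.\<close>
  proof (cases "n i = 0")
    case True
    then have "P i = 0" using P(1)[OF i] by simp
    then show ?thesis by (simp add: in_span_zero)
  next
    case False
    then have "int (degree (P i)) \<le> n i - 1" using P(1)[OF i] by simp
    then have "in_span (space w) p u n (\<lambda>x. \<Sum>l\<le>degree (P i). coeff (P i) l * wmono u (i, l) x)"
      using i by (intro in_span_sum in_span_wmono) (auto simp: idx_def)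
    then show ?thesis by (simp add: poly_altdef sum_distrib_right wmono_def mult.assoc)
  qed
  then have "in_span (space w) p u n (\<lambda>x. \<Sum>i=1..p. 1 * (poly (P i) x * u i x))"
    by (intro in_span_sum) auto
  then show "in_span (space w) p u n F" using P(2) by (rule in_span_eqI)
  show "\<exists>x\<in>space w. F x \<noteq> 0" using assms by (auto simp: mixed_form_def)
  show "orth w q v m F"
    using assms by (auto simp: mixed_form_def orth_def pairing_def wmono_def idx_def ac_simps)
qed

text \<open>The hypotheses are symmetric in \<open>(p, u)\<close> and \<open>(q, v)\<close>, so
  \<open>swap\<close> turns every fact about one type of form into a fact about the other. By
  \<open>infinite_support\<close> no finite set carries the measure; hence a product of two nonzero
  combinations cannot vanish almost everywhere.\<close>

locale AT_pair =
  fixes \<Delta> :: "real set" and w :: "real measure" and p q :: nat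
    and u v :: "nat \<Rightarrow> real \<Rightarrow> real"
  assumes interval: "is_interval \<Delta>"
    and sets_w: "sets w = sets (restrict_space borel \<Delta>)"
    and infinite_support: "\<And>Z. finite Z \<Longrightarrow> Z \<subseteq> \<Delta> \<Longrightarrow> emeasure w (\<Delta> - Z) > 0"
    and moments: "\<And>r i j. i \<in> {1..p} \<Longrightarrow> j \<in> {1..q} \<Longrightarrow> integrable w (\<lambda>x. x ^ r * u i x * v j x)"
    and AT_u: "AT_system \<Delta> p u" and AT_v: "AT_system \<Delta> q v"
begin

lemma swap: "AT_pair \<Delta> w q p v u"
proof
  fix r i j assume "i \<in> {1..q}" "j \<in> {1..p}"
  then show "integrable w (\<lambda>x. x ^ r * v i x * u j x)"
    using moments[of j i r] by (simp add: ac_simps)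
qed (use interval sets_w infinite_support AT_u AT_v in auto)

lemma space_w: "space w = \<Delta>"
  using sets_eq_imp_space_eq[OF sets_w] by (simp add: space_restrict_space)

lemma infinite_interval: "infinite \<Delta>"
  using infinite_support[of \<Delta>] by auto

lemma integrable_product:
  assumes "in_span \<Delta> p u n F" "in_span \<Delta> q v m G"
  shows "integrable w (\<lambda>x. F x * G x)"
proof -
  obtain c where c: "\<And>x. x \<in> \<Delta> \<Longrightarrow> F x = (\<Sum>a\<in>idx p n. c a * wmono u a x)"
    using assms by (auto simp: in_span_def)
  obtain d where d: "\<And>x. x \<in> \<Delta> \<Longrightarrow> G x = (\<Sum>b\<in>idx q m. d b * wmono v b x)"
    using assms by (auto simp: in_span_def)
  have "integrable w (\<lambda>x. (c a * d b) * (x ^ (snd a + snd b) * u (fst a) x * v (fst b) x))"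
    if "a \<in> idx p n" "b \<in> idx q m" for a b
    using that by (intro integrable_mult_right moments) (auto simp: idx_def)
  then have "integrable w (\<lambda>x. c a * wmono u a x * (d b * wmono v b x))"
    if "a \<in> idx p n" "b \<in> idx q m" for a b
    using that by (simp add: wmono_def case_prod_unfold power_add ac_simps)
  then have "integrable w (\<lambda>x. \<Sum>a\<in>idx p n. \<Sum>b\<in>idx q m. c a * wmono u a x * (d b * wmono v b x))"
    by (intro Bochner_Integration.integrable_sum)
  moreover have "F x * G x = (\<Sum>a\<in>idx p n. \<Sum>b\<in>idx q m. c a * wmono u a x * (d b * wmono v b x))"
    if "x \<in> space w" for x
    using that c d by (simp add: space_w sum_product)
  ultimately show ?thesis
    using Bochner_Integration.integrable_cong[OF refl, of w] by (metis (no_types, lifting))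
qed

lemma pairing_sum:
  assumes F: "in_span \<Delta> p u n F" and G: "\<And>i. i \<in> K \<Longrightarrow> in_span \<Delta> q v m (G i)"
  shows "pairing w F (\<lambda>x. \<Sum>i\<in>K. c i * G i x) = (\<Sum>i\<in>K. c i * pairing w F (G i))"
proof -
  have "pairing w F (\<lambda>x. \<Sum>i\<in>K. c i * G i x) = (LINT x|w. (\<Sum>i\<in>K. c i * (F x * G i x)))"
    unfolding pairing_def by (simp add: sum_distrib_left ac_simps)
  also have "\<dots> = (\<Sum>i\<in>K. LINT x|w. c i * (F x * G i x))"
    using integrable_product[OF F G] by (intro Bochner_Integration.integral_sum) auto
  finally show ?thesis by (simp add: pairing_def)
qed

lemma pairing_cong:
  assumes "\<And>x. x \<in> \<Delta> \<Longrightarrow> F x = F' x" "\<And>x. x \<in> \<Delta> \<Longrightarrow> G x = G' x"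
  shows "pairing w F G = pairing w F' G'"
  unfolding pairing_def using assms by (intro Bochner_Integration.integral_cong) (auto simp: space_w)

lemma pairing_orth:
  assumes F: "in_span \<Delta> p u n F" "orth w q v m F" and G: "in_span \<Delta> q v m G"
  shows "pairing w F G = 0"
proof -
  obtain d where d: "\<And>x. x \<in> \<Delta> \<Longrightarrow> G x = (\<Sum>b\<in>idx q m. d b * wmono v b x)"
    using G by (auto simp: in_span_def)
  have "pairing w F G = pairing w F (\<lambda>x. \<Sum>b\<in>idx q m. d b * wmono v b x)"
    using d by (intro pairing_cong) auto
  also have "\<dots> = (\<Sum>b\<in>idx q m. d b * pairing w F (wmono v b))"
    by (intro pairing_sum[OF F(1), of _ m] in_span_wmono) auto
  also have "\<dots> = 0" using F(2) by (simp add: orth_def)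
  finally show ?thesis .
qed

text \<open>Otherwise \<open>F\<close> has fewer than \<open>|m|\<close> sign changes, and some \<open>G\<close> in the span of the \<open>x\<^sup>k v\<^sub>j\<close> has the same
  ones, so that \<open>\<integral> F G dw\<close> could not vanish.\<close>

theorem normality:
  assumes n: "multi_index p n" and m: "multi_index q m" and size: "msize p n = msize q m"
    and F: "in_span \<Delta> p u n F" "orth w q v m F"
  shows "\<forall>x\<in>\<Delta>. F x = 0"
proof (rule ccontr)
  assume nz: "\<not> ?thesis"
  obtain c where c: "\<And>x. x \<in> \<Delta> \<Longrightarrow> F x = (\<Sum>a\<in>idx p n. c a * wmono u a x)"
    using F by (auto simp: in_span_def)
  have cheb: "chebyshev_system \<Delta> (idx p n) (wmono u)" by (rule AT_systemD[OF AT_u n])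
  have c0: "\<exists>a\<in>idx p n. c a \<noteq> 0"
  proof (rule ccontr)
    assume "\<not> ?thesis"
    then have "\<forall>x\<in>\<Delta>. F x = 0" using c by auto
    then show False using nz by simp
  qed
  define Z where "Z = {x \<in> \<Delta>. F x = 0}"
  have Zeq: "Z = {x \<in> \<Delta>. (\<Sum>a\<in>idx p n. c a * wmono u a x) = 0}" using c by (auto simp: Z_def)
  have Z: "finite Z" "card Z \<le> card (idx p n) - 1"
    unfolding Zeq using cheb c0 unfolding chebyshev_system_def by blast+
  have cards: "card (idx p n) = card (idx q m)" using size card_idx n m by (metis of_nat_eq_iff)
  have pos: "card (idx p n) > 0" using c0 by (auto simp: card_gt_0_iff)
  have "continuous_on \<Delta> (\<lambda>x. \<Sum>a\<in>idx p n. c a * wmono u a x)"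
    using cheb unfolding chebyshev_system_def by (intro continuous_intros) auto
  then have "continuous_on \<Delta> F" using c by (simp cong: continuous_on_cong)
  then obtain S \<sigma> where S: "S \<subseteq> Z" "\<sigma> \<in> {1, -1}" "\<forall>s\<in>S. (\<exists>a\<in>\<Delta>. a < s) \<and> (\<exists>b\<in>\<Delta>. s < b)"
      "\<forall>x\<in>\<Delta>. 0 \<le> \<sigma> * F x * (\<Prod>s\<in>S. x - s)"
    using sign_pattern[of \<Delta> F] Z interval unfolding Z_def by blast
  have finS: "finite S" using S Z finite_subset by blast
  \<comment> \<open>\<open>S\<close> consists of zeros of \<open>F\<close>, at most |n| - 1 = |m| -
    1 in number, so there is room below \<open>m\<close> for one function more than \<open>S\<close>
    has points.\<close>
  have "card S + 1 \<le> card (idx q m)"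
    using card_mono[OF Z(1) S(1)] Z(2) cards pos by linarith
  then obtain k where k: "multi_index q k" "k \<le> m" "card (idx q k) = card S + 1"
    using exists_smaller_multi_index[OF m] by blast
  have chebv: "chebyshev_system \<Delta> (idx q k) (wmono v)" by (rule AT_systemD[OF AT_v k(1)])
  have "S \<subseteq> \<Delta>" using S Z_def by auto
  then obtain g \<tau> where g: "\<exists>i\<in>idx q k. g i \<noteq> 0" "\<tau> \<in> {1, -1::real}"
      "\<forall>x\<in>\<Delta>. 0 \<le> \<tau> * (\<Sum>i\<in>idx q k. g i * wmono v i x) * (\<Prod>s\<in>S. x - s)"
    using chebyshev_prescribed_sign_changes[OF chebv interval infinite_interval finS _ k(3)] S(3)
    by blast
  define G where "G = (\<lambda>x. \<Sum>i\<in>idx q k. g i * wmono v i x)"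
  define Y where "Y = {x \<in> \<Delta>. G x = 0}"
  have Y: "finite Y"
    unfolding Y_def G_def using chebv g(1) unfolding chebyshev_system_def by blast
  have "in_span \<Delta> q v k G" unfolding G_def by (intro in_span_sum in_span_wmono)
  then have G: "in_span \<Delta> q v m G" using in_span_mono k(2) by blast
  have nonneg: "0 \<le> \<sigma> * \<tau> * (F x * G x)" if x: "x \<in> \<Delta>" for x
  proof (cases "x \<in> S")
    case True
    then show ?thesis using S(1) by (auto simp: Z_def)
  next
    case False
    then have ne: "(\<Prod>s\<in>S. x - s) \<noteq> 0" using finS by auto
    have "0 \<le> (\<sigma> * F x * (\<Prod>s\<in>S. x - s)) * (\<tau> * G x * (\<Prod>s\<in>S. x - s))"
      using S(4) g(3) x unfolding G_def by (meson mult_nonneg_nonneg)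
    also have "\<dots> = \<sigma> * \<tau> * (F x * G x) * (\<Prod>s\<in>S. x - s)\<^sup>2"
      by (simp add: power2_eq_square ac_simps)
    finally show ?thesis using ne by (simp add: zero_le_mult_iff)
  qed
  have "pairing w F G = 0" by (rule pairing_orth[OF F G])
  then have "(LINT x|w. \<sigma> * \<tau> * (F x * G x)) = 0" by (simp add: pairing_def)
  then have "AE x in w. \<sigma> * \<tau> * (F x * G x) = 0"
    using integrable_product[OF F(1) G] nonneg
    by (subst (asm) integral_nonneg_eq_0_iff_AE) (auto simp: space_w)
  \<comment> \<open>A vanishing product puts the point among the finitely many zeros of
    \<open>F\<close> or of \<open>G\<close>, so a finite set would carry the whole measure.\<close>
  then have AE: "AE x in w. x \<in> Z \<union> Y"
    by (rule AE_mp) (use S(2) g(2) in \<open>auto simp: Z_def Y_def space_w\<close>)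
  have "\<Delta> - (Z \<union> Y) \<in> sets w"
    unfolding sets_w sets_restrict_space using Z Y
    by (auto intro!: image_eqI[of _ _ "- (Z \<union> Y)"] borel_open simp: finite_imp_closed open_closed)
  moreover have "{x \<in> space w. x \<notin> Z \<union> Y} = \<Delta> - (Z \<union> Y)" by (auto simp: space_w)
  ultimately have "emeasure w (\<Delta> - (Z \<union> Y)) = 0"
    using AE AE_iff_measurable[of "\<Delta> - (Z \<union> Y)" w "\<lambda>x. x \<in> Z \<union> Y"] by simp
  moreover have "emeasure w (\<Delta> - (Z \<union> Y)) > 0"
    using Z Y by (intro infinite_support) (auto simp: Z_def Y_def)
  ultimately show False by simp
qed

end

section \<open>Biorthogonal expansion along a chain\<close>

context AT_pair
begin

text \<open>This is maximality of the degree in component \<open>e\<close>: without the top function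
  \<open>F\<close> would lie in the span at \<open>k\<close>, where |k| = |m|, and would vanish by
  normality.\<close>

lemma type_I_leading_term:
  assumes k: "multi_index p k" "e \<in> {1..p}" and m: "multi_index q m" "msize p k = msize q m"
    and F: "mixed_form w p u (k + munit e) q v m F"
  obtains c F0 where "c \<noteq> 0" "in_span \<Delta> p u k F0"
    "\<And>x. x \<in> \<Delta> \<Longrightarrow> F x = c * wmono u (e, nat (k e)) x + F0 x"
proof -
  note F' = mixed_formD[OF F, unfolded space_w]
  obtain C where C: "\<And>x. x \<in> \<Delta> \<Longrightarrow> F x = (\<Sum>a\<in>idx p (k + munit e). C a * wmono u a x)"
    using F'(1) by (auto simp: in_span_def)
  define F0 where "F0 = (\<lambda>x. \<Sum>a\<in>idx p k. C a * wmono u a x)"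
  define c where "c = C (e, nat (k e))"
  have F0: "in_span \<Delta> p u k F0" unfolding F0_def by (intro in_span_sum in_span_wmono)
  have eq: "F x = c * wmono u (e, nat (k e)) x + F0 x" if "x \<in> \<Delta>" for x
    using C[OF that] idx_add_munit[OF k] by (simp add: F0_def c_def)
  have "c \<noteq> 0"
  proof
    assume "c = 0"
    then have "in_span \<Delta> p u k F" using eq by (intro in_span_eqI[OF F0]) simp
    then show False using normality[OF k(1) m] F'(2,3) by blast
  qed
  then show ?thesis using F0 eq that by blast
qed

text \<open>Modulo the span at \<open>k\<close>, to which \<open>R\<close> is already orthogonal,
  \<open>F\<close> is a nonzero multiple of the one function that \<open>munit e\<close> adds. A
  vanishing pairing with \<open>F\<close> is thus worth exactly the one missing condition.\<close>

lemma orth_extend: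
  assumes k: "multi_index p k" "e \<in> {1..p}" and m: "multi_index q m" "msize p k = msize q m"
    and F: "mixed_form w p u (k + munit e) q v m F"
    and R: "in_span \<Delta> q v l R" "orth w p u k R" and zero: "pairing w F R = 0"
  shows "orth w p u (k + munit e) R"
proof -
  interpret swapped: AT_pair \<Delta> w q p v u by (rule swap)
  obtain c F0 where c: "c \<noteq> 0" and F0: "in_span \<Delta> p u k F0"
    and eq: "\<And>x. x \<in> \<Delta> \<Longrightarrow> F x = c * wmono u (e, nat (k e)) x + F0 x"
    using type_I_leading_term[OF k m F] by blast
  define f where "f = wmono u (e, nat (k e))"
  have f: "in_span \<Delta> p u (k + munit e) f"
    unfolding f_def using idx_add_munit[OF k] by (intro in_span_wmono) simp
  have k_le: "k \<le> k + munit e" by (simp add: le_fun_def munit_def)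
  \<comment> \<open>The two-term sum over Booleans brings linearity within reach of
    \<open>pairing_sum\<close>.\<close>
  have "pairing w R F = pairing w R (\<lambda>x. \<Sum>b\<in>{True, False}. (if b then c else 1) * (if b then f else F0) x)"
    using eq by (intro pairing_cong) (auto simp: f_def)
  also have "\<dots> = (\<Sum>b\<in>{True, False}. (if b then c else 1) * pairing w R (if b then f else F0))"
    using f in_span_mono[OF F0 k_le] by (intro swapped.pairing_sum[OF R(1), of _ "k + munit e"]) auto
  also have "\<dots> = c * pairing w R f"
    using swapped.pairing_orth[OF R F0] by simp
  finally have "pairing w R f = 0" using zero c by (simp add: pairing_def mult.commute)
  then show ?thesis using R(2) idx_add_munit(1)[OF k] by (simp add: orth_def f_def)
qed

text \<open>A zero pairing would extend the orthogonality of \<open>G\<close> to an index as large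
  as that of its span, and \<open>G\<close> would vanish. All denominators of the coefficients are
  pairings of this kind.\<close>

lemma pairing_nonzero:
  assumes k: "multi_index p k" "e \<in> {1..p}" and m: "multi_index q m" "e' \<in> {1..q}"
    and size: "msize p k = msize q m"
    and F: "mixed_form w p u (k + munit e) q v m F"
    and G: "mixed_form w q v (m + munit e') p u k G"
  shows "pairing w F G \<noteq> 0"
proof
  interpret swapped: AT_pair \<Delta> w q p v u by (rule swap)
  assume zero: "pairing w F G = 0"
  note G' = mixed_formD[OF G, unfolded space_w]
  have "orth w p u (k + munit e) G"
    by (rule orth_extend[OF k m(1) size F G'(1,2) zero])
  moreover have "multi_index p (k + munit e)" "multi_index q (m + munit e')"
    using k m by (auto simp: multi_index_def munit_def le_fun_def)
  moreover have "msize q (m + munit e') = msize p (k + munit e)"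
    using msize_add_munit k m size by simp
  ultimately show False using swapped.normality[of "m + munit e'" "k + munit e" G] G'(1,3) by blast
qed

text \<open>The forms \<open>A (N (k + 1)) (M (k - 1))\<close> are biorthogonal to the \<open>B (N k) (M k)\<close>. The remainder of the
  expansion is orthogonal to all of them, which upgrades its orthogonality from \<open>N (- p)\<close> step by step
  to \<open>N (q + 1)\<close>; then it vanishes by normality.\<close>

theorem chain_recurrence:
  fixes N M :: "int \<Rightarrow> mindex"
  assumes A: "\<And>n m. multi_index p n \<Longrightarrow> multi_index q m \<Longrightarrow> msize p n = msize q m + 1 \<Longrightarrow>
      mixed_form w p u n q v m (A n m)"
    and B: "\<And>n m. multi_index p n \<Longrightarrow> multi_index q m \<Longrightarrow> msize q m = msize p n + 1 \<Longrightarrow>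
      mixed_form w q v m p u n (B n m)"
    and N: "\<And>k. k \<in> {- int p..int q + 1} \<Longrightarrow> multi_index p (N k)"
    and M: "\<And>k. k \<in> {- int p - 1..int q} \<Longrightarrow> multi_index q (M k)"
    and N_step: "\<And>k. k \<in> {- int p..int q} \<Longrightarrow> \<exists>e\<in>{1..p}. N (k + 1) = N k + munit e"
    and M_step: "\<And>k. k \<in> {- int p..int q} \<Longrightarrow> \<exists>e\<in>{1..q}. M k = M (k - 1) + munit e"
    and size: "msize q (M 0) = msize p (N 0) + 1"
    and N_bot: "N (- int p) = N 0 - mones p" and M_top: "M (int q) = M 0 + mones q"
  shows "\<And>k. k \<in> {- int p..int q} \<Longrightarrow> pairing w (A (N (k + 1)) (M (k - 1))) (B (N k) (M k)) \<noteq> 0"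
    and "x \<in> \<Delta> \<Longrightarrow> x * B (N 0) (M 0) x =
      (\<Sum>k\<in>{- int p..int q}. pairing w (\<lambda>x. x * A (N (k + 1)) (M (k - 1)) x) (B (N 0) (M 0)) /
         pairing w (A (N (k + 1)) (M (k - 1))) (B (N k) (M k)) * B (N k) (M k) x)"
proof -
  interpret swapped: AT_pair \<Delta> w q p v u by (rule swap)
  let ?K = "{- int p..int q}"
  have N_mono: "N k \<le> N l" if "k \<le> l" "- int p \<le> k" "l \<le> int q + 1" for k l
    using that
  proof (induction l rule: int_ge_induct)
    case (step i)
    then obtain e where "N (i + 1) = N i + munit e" using N_step[of i] by auto
    moreover have "N k \<le> N i" using step by auto
    ultimately show ?case by (auto simp: le_fun_def munit_def intro: add_increasing2)
  qed simp
  have M_mono: "M k \<le> M l" if "k \<le> l" "- int p - 1 \<le> k" "l \<le> int q" for k l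
    using that
  proof (induction l rule: int_ge_induct)
    case (step i)
    then obtain e where "M (i + 1) = M i + munit e" using M_step[of "i + 1"] by auto
    moreover have "M k \<le> M i" using step by auto
    ultimately show ?case by (auto simp: le_fun_def munit_def intro: add_increasing2)
  qed simp
  have size_diff: "msize q (M k) - msize p (N k) = 1" if "k \<in> ?K" for k
  proof -
    have invariant: "msize q (M (k + 1)) - msize p (N (k + 1)) = msize q (M k) - msize p (N k)"
      if k: "- int p \<le> k" "k < int q" for k
    proof -
      obtain e where "e \<in> {1..p}" "N (k + 1) = N k + munit e" using N_step[of k] k by auto
      moreover obtain e' where "e' \<in> {1..q}" "M (k + 1) = M k + munit e'"
        using M_step[of "k + 1"] k by auto
      ultimately show ?thesis by (simp add: msize_add_munit)
    qed
    \<comment> \<open>The induction climbs from the bottom of the range; comparison with the value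
      at 0 then identifies the constant as 1.\<close>
    have const: "msize q (M k) - msize p (N k) = msize q (M (- int p)) - msize p (N (- int p))"
      if "- int p \<le> k" "k \<le> int q" for k
      using that
    proof (induction k rule: int_ge_induct)
      case (step i)
      then show ?case using invariant[of i] by auto
    qed simp
    show ?thesis using const[of k] const[of 0] size that by auto
  qed
  have formB: "mixed_form w q v (M k) p u (N k) (B (N k) (M k))" if "k \<in> ?K" for k
    using that size_diff[OF that] by (intro B N M) auto
  \<comment> \<open>\<open>(N k, M (k - 1))\<close> is the balanced pair: a unit step in the first
    index leads to the type I form, one in the second to the type II form.\<close>
  have size_A: "msize p (N k) = msize q (M (k - 1))" "msize p (N (k + 1)) = msize q (M (k - 1)) + 1"
    if k: "k \<in> ?K" for k
  proof -
    obtain e where "e \<in> {1..p}" "N (k + 1) = N k + munit e" using N_step[OF k] by auto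
    moreover obtain e' where "e' \<in> {1..q}" "M k = M (k - 1) + munit e'" using M_step[OF k] by auto
    ultimately show "msize p (N k) = msize q (M (k - 1))" "msize p (N (k + 1)) = msize q (M (k - 1)) + 1"
      using size_diff[OF k] by (auto simp: msize_add_munit)
  qed
  have formA: "mixed_form w p u (N (k + 1)) q v (M (k - 1)) (A (N (k + 1)) (M (k - 1)))"
    if "k \<in> ?K" for k
    using that size_A[OF that] by (intro A N M) auto
  show nonzero: "pairing w (A (N (k + 1)) (M (k - 1))) (B (N k) (M k)) \<noteq> 0" if k: "k \<in> ?K" for k
  proof -
    obtain e where e: "e \<in> {1..p}" "N (k + 1) = N k + munit e" using N_step[OF k] by auto
    obtain e' where e': "e' \<in> {1..q}" "M k = M (k - 1) + munit e'" using M_step[OF k] by auto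
    have "multi_index p (N k)" "multi_index q (M (k - 1))" using k by (auto intro!: N M)
    then show ?thesis
      using pairing_nonzero[OF _ e(1) _ e'(1) size_A(1)[OF k]] formA[OF k] formB[OF k] e(2) e'(2) by simp
  qed
  define \<alpha> where "\<alpha> = (\<lambda>k. A (N (k + 1)) (M (k - 1)))"
  define \<beta> where "\<beta> = (\<lambda>k. B (N k) (M k))"
  have \<alpha>: "in_span \<Delta> p u (N (k + 1)) (\<alpha> k)" "orth w q v (M (k - 1)) (\<alpha> k)" if "k \<in> ?K" for k
    using mixed_formD[OF formA[OF that]] by (auto simp: \<alpha>_def space_w)
  have \<beta>: "in_span \<Delta> q v (M k) (\<beta> k)" "orth w p u (N k) (\<beta> k)" if "k \<in> ?K" for k
    using mixed_formD[OF formB[OF that]] by (auto simp: \<beta>_def space_w)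
  \<comment> \<open>For \<open>l < k\<close> the orthogonality of \<open>\<alpha> k\<close> covers
    the span of \<open>\<beta> l\<close>; for \<open>l > k\<close> that of \<open>\<beta> l\<close>
    covers the span of \<open>\<alpha> k\<close>.\<close>
  have biorth: "pairing w (\<alpha> k) (\<beta> l) = 0" if kl: "k \<in> ?K" "l \<in> ?K" "k \<noteq> l" for k l
  proof (cases "l < k")
    case True
    then have "in_span \<Delta> q v (M (k - 1)) (\<beta> l)"
      using kl by (intro in_span_mono[OF \<beta>(1)] M_mono) auto
    then show ?thesis using pairing_orth[OF \<alpha>[OF kl(1)]] by blast
  next
    case False
    then have "in_span \<Delta> p u (N l) (\<alpha> k)"
      using kl by (intro in_span_mono[OF \<alpha>(1)] N_mono) auto
    then have "pairing w (\<beta> l) (\<alpha> k) = 0" using swapped.pairing_orth[OF \<beta>[OF kl(2)]] by blast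
    then show ?thesis by (simp add: pairing_def mult.commute)
  qed
  define b where "b = (\<lambda>k. pairing w (\<lambda>x. x * \<alpha> k x) (\<beta> 0) / pairing w (\<alpha> k) (\<beta> k))"
  define T where "T = (\<lambda>x. \<Sum>k\<in>?K. b k * \<beta> k x)"
  define R where "R = (\<lambda>x. x * \<beta> 0 x - T x)"
  have \<beta>_top: "in_span \<Delta> q v (M (int q)) (\<beta> k)" if "k \<in> ?K" for k
    using that by (intro in_span_mono[OF \<beta>(1)] M_mono) auto
  have x\<beta>: "in_span \<Delta> q v (M (int q)) (\<lambda>x. x * \<beta> 0 x)"
    unfolding M_top using \<beta>(1)[of 0] by (intro in_span_times_x) auto
  have T: "in_span \<Delta> q v (M (int q)) T" unfolding T_def by (intro in_span_sum \<beta>_top)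
  have R: "in_span \<Delta> q v (M (int q)) R" unfolding R_def by (intro in_span_diff x\<beta> T)
  have pairing_R: "pairing w F R = pairing w F (\<lambda>x. x * \<beta> 0 x) - (\<Sum>k\<in>?K. b k * pairing w F (\<beta> k))"
    if "in_span \<Delta> p u n F" for F n
  proof -
    have "pairing w F R = pairing w F (\<lambda>x. x * \<beta> 0 x) - pairing w F T"
      unfolding pairing_def R_def right_diff_distrib
      by (intro Bochner_Integration.integral_diff integrable_product[OF that x\<beta>] integrable_product[OF that T])
    also have "pairing w F T = (\<Sum>k\<in>?K. b k * pairing w F (\<beta> k))"
      unfolding T_def by (rule pairing_sum[OF that \<beta>_top])
    finally show ?thesis .
  qed
  have \<alpha>R: "pairing w (\<alpha> k) R = 0" if k: "k \<in> ?K" for k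
  proof -
    have "(\<Sum>l\<in>?K. b l * pairing w (\<alpha> k) (\<beta> l)) = b k * pairing w (\<alpha> k) (\<beta> k)"
      using k biorth by (subst sum.remove[of _ k]) (auto intro!: sum.neutral)
    also have "\<dots> = pairing w (\<lambda>x. x * \<alpha> k x) (\<beta> 0)"
      using nonzero[OF k] by (simp add: b_def \<alpha>_def \<beta>_def)
    also have "\<dots> = pairing w (\<alpha> k) (\<lambda>x. x * \<beta> 0 x)"
      by (simp add: pairing_def ac_simps)
    finally show ?thesis using pairing_R[OF \<alpha>(1)[OF k]] by simp
  qed
  \<comment> \<open>By \<open>N_bot\<close>, x times \<open>\<beta> 0\<close> stays orthogonal at
    the lowest index, and every \<open>\<beta> k\<close> is orthogonal there because
    \<open>N\<close> increases.\<close>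
  have base: "orth w p u (N (- int p)) R"
    unfolding orth_def
  proof
    fix a assume a: "a \<in> idx p (N (- int p))"
    have 1: "pairing w (\<beta> k) (wmono u a) = 0" if "k \<in> ?K" for k
      using a orth_antimono[OF \<beta>(2)[OF that] N_mono] that by (auto simp: orth_def)
    have "orth w p u (N (- int p)) (\<lambda>x. x * \<beta> 0 x)"
      unfolding N_bot using \<beta>(2)[of 0] by (intro orth_times_x) auto
    then have "pairing w (\<lambda>x. x * \<beta> 0 x) (wmono u a) = 0" using a by (auto simp: orth_def)
    then have "pairing w (wmono u a) R = 0"
      using pairing_R[OF in_span_wmono[OF a]] 1
      by (simp add: pairing_def mult.commute mult.left_commute)
    then show "pairing w R (wmono u a) = 0" by (simp add: pairing_def mult.commute)
  qed
  have R_orth: "orth w p u (N k) R" if "- int p \<le> k" "k \<le> int q + 1" for k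
    using that
  proof (induction k rule: int_ge_induct)
    case base
    show ?case by (rule \<open>orth w p u (N (- int p)) R\<close>)
  next
    case (step k)
    then have k: "k \<in> ?K" by auto
    obtain e where e: "e \<in> {1..p}" "N (k + 1) = N k + munit e" using N_step[OF k] by auto
    have "multi_index p (N k)" "multi_index q (M (k - 1))" using k by (auto intro!: N M)
    then show ?case
      unfolding e(2)
      using step k formA[OF k] \<alpha>R[OF k]
      by (intro orth_extend[OF _ e(1) _ size_A(1)[OF k] _ R]) (auto simp: e(2) \<alpha>_def)
  qed
  \<comment> \<open>The size of \<open>N (int q)\<close> is one short of that of
    \<open>M (int q)\<close>; the extra index \<open>N (int q + 1)\<close> restores the balance that
    normality requires.\<close>
  have "msize q (M (int q)) = msize p (N (int q + 1))"
  proof -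
    obtain e where "e \<in> {1..p}" "N (int q + 1) = N (int q) + munit e" using N_step[of "int q"] by auto
    then show ?thesis using size_diff[of "int q"] by (simp add: msize_add_munit)
  qed
  then have "\<forall>x\<in>\<Delta>. R x = 0"
    by (intro swapped.normality[OF _ _ _ R R_orth[of "int q + 1"]] N M) auto
  then show "x \<in> \<Delta> \<Longrightarrow> x * B (N 0) (M 0) x =
      (\<Sum>k\<in>{- int p..int q}. pairing w (\<lambda>x. x * A (N (k + 1)) (M (k - 1)) x) (B (N 0) (M 0)) /
         pairing w (A (N (k + 1)) (M (k - 1))) (B (N k) (M k)) * B (N k) (M k) x)"
    by (simp add: R_def T_def b_def \<alpha>_def \<beta>_def)
qed

end

section \<open>Paths of multi-indices\<close>

lemma mpath_zero [simp]: "mpath d \<pi> 0 = 0"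
  by (simp add: mpath_def fun_eq_iff)

lemma sum_munit_permutes:
  assumes "\<pi> permutes {1..d}"
  shows "(\<Sum>l=1..d. munit (\<pi> l) i) = mones d i"
proof -
  have "(\<Sum>l=1..d. munit (\<pi> l) i) = (\<Sum>l=1..d. munit l i)"
    using sum.permute[OF assms, of "\<lambda>l. munit l i"] by (simp add: o_def)
  then show ?thesis by (simp add: munit_def mones_def)
qed

lemma mpath_Suc:
  assumes "\<pi> permutes {1..d}" "d \<ge> 1"
  shows "\<exists>e\<in>{1..d}. mpath d \<pi> (Suc k) = mpath d \<pi> k + munit e"
proof
  let ?r = "k mod d"
  have r: "?r < d" using assms by simp
  show "\<pi> (Suc ?r) \<in> {1..d}" using permutes_in_image[OF assms(1)] r by simp
  show "mpath d \<pi> (Suc k) = mpath d \<pi> k + munit (\<pi> (Suc ?r))"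
  \<comment> \<open>Here a round is completed: the sum over the whole permutation is
    \<open>mones d\<close>, which the quotient absorbs.\<close>
  proof (cases "Suc ?r = d")
    case True
    then have "Suc k mod d = 0" "Suc k div d = Suc (k div d)" by (simp_all add: mod_Suc div_Suc)
    moreover have "(\<Sum>l=1..?r. munit (\<pi> l) i) + munit (\<pi> (Suc ?r)) i = mones d i" for i
      using sum_munit_permutes[OF assms(1), of i] True by (metis One_nat_def sum.cl_ivl_Suc le_add1 plus_1_eq_Suc not_less_eq_eq not_less)
    ultimately show ?thesis
      by (simp add: mpath_def fun_eq_iff algebra_simps)
  next
    case False
    then have "Suc k mod d = Suc ?r" "Suc k div d = k div d" by (simp_all add: mod_Suc div_Suc)
    then show ?thesis by (simp add: mpath_def fun_eq_iff)
  qed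
qed

lemma mpath_period: "d \<ge> 1 \<Longrightarrow> mpath d \<pi> d = mones d"
  by (simp add: mpath_def fun_eq_iff)

lemma multi_index_mpath:
  assumes "\<pi> permutes {1..d}" "d \<ge> 1"
  shows "multi_index d (mpath d \<pi> k)"
proof (induction k)
  case 0
  then show ?case by (simp add: multi_index_def le_fun_def)
next
  case (Suc k)
  then show ?case using mpath_Suc[OF assms, of k]
    by (auto simp: multi_index_def munit_def le_fun_def)
qed

lemma multi_index_add: "multi_index d k \<Longrightarrow> multi_index d l \<Longrightarrow> multi_index d (k + l)"
  by (auto simp: multi_index_def le_fun_def)

lemma multi_index_diff: "multi_index d k \<Longrightarrow> multi_index d l \<Longrightarrow> 0 \<le> k - l \<Longrightarrow> multi_index d (k - l)"
  by (auto simp: multi_index_def)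

text \<open>Two paths are glued at \<open>n\<close> into one indexed by the integers, so that the
  three groups of terms of a recurrence become one sum. The branches agree at 0 when both paths
  start at 0.\<close>

definition chain :: "mindex \<Rightarrow> mpaths \<Rightarrow> mpaths \<Rightarrow> int \<Rightarrow> mindex" where
  "chain n up down k = (if 0 \<le> k then n + up (nat k) else n - down (nat (- k)))"

lemma chain_of_nat [simp]: "chain n up down (int k) = n + up k"
  by (simp add: chain_def)

lemma chain_minus [simp]: "up 0 = 0 \<Longrightarrow> down 0 = 0 \<Longrightarrow> chain n up down (- int k) = n - down k"
  by (auto simp: chain_def)

lemma chain_step:
  assumes \<pi>: "\<pi> permutes {1..d}" "\<rho> permutes {1..d}" and d: "d \<ge> 1"
  shows "\<exists>e\<in>{1..d}. chain n (mpath d \<pi>) (mpath d \<rho>) (k + 1) = chain n (mpath d \<pi>) (mpath d \<rho>) k + munit e"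
proof (cases "0 \<le> k")
  case True
  then have "nat (k + 1) = Suc (nat k)" by simp
  then show ?thesis using True mpath_Suc[OF \<pi>(1) d, of "nat k"] by (auto simp: chain_def add.assoc)
next
  case False
  \<comment> \<open>Below 0 an upward step of the chain undoes a step of \<open>down\<close>, from
    \<open>Suc j\<close> back to \<open>j\<close>.\<close>
  define j where "j = nat (- k - 1)"
  have k: "k = - int (Suc j)" "k + 1 = - int j" using False by (auto simp: j_def)
  obtain e where "e \<in> {1..d}" "mpath d \<rho> (Suc j) = mpath d \<rho> j + munit e"
    using mpath_Suc[OF \<pi>(2) d, of j] by blast
  then show ?thesis unfolding k(2) unfolding k(1)
    by (intro bexI[of _ e]) (simp_all only: chain_minus mpath_zero, simp)
qed

lemma multi_index_chain:
  assumes "\<pi> permutes {1..d}" "\<rho> permutes {1..d}" "d \<ge> 1" "multi_index d n"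
    and "\<And>i. k = - int i \<Longrightarrow> 0 \<le> n - mpath d \<rho> i"
  shows "multi_index d (chain n (mpath d \<pi>) (mpath d \<rho>) k)"
proof (cases "0 \<le> k")
  case True
  then show ?thesis using assms multi_index_mpath by (auto simp: chain_def intro: multi_index_add)
next
  case False
  then show ?thesis using assms(5)[of "nat (- k)"] assms multi_index_mpath
    by (auto simp: chain_def intro!: multi_index_diff)
qed

lemma sum_int_symmetric:
  fixes f :: "int \<Rightarrow> real"
  shows "(\<Sum>k\<in>{- int p..int q}. f k) = (\<Sum>j=1..q. f (int j)) + f 0 + (\<Sum>i=1..p. f (- int i))"
proof -
  have "{- int p..int q} = int ` {1..q} \<union> {0} \<union> (\<lambda>i. - int i) ` {1..p}"
  proof (intro equalityI subsetI)
    fix k assume k: "k \<in> {- int p..int q}"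
    consider "k > 0" | "k = 0" | "k < 0" by linarith
    then show "k \<in> int ` {1..q} \<union> {0} \<union> (\<lambda>i. - int i) ` {1..p}"
    proof cases
      case 1
      then show ?thesis using k by (auto intro!: image_eqI[of _ _ "nat k"])
    next
      case 3
      then show ?thesis using k by (auto intro!: image_eqI[of _ _ "nat (- k)"])
    qed simp
  qed auto
  then have "(\<Sum>k\<in>{- int p..int q}. f k) =
      (\<Sum>k\<in>int ` {1..q} \<union> {0}. f k) + (\<Sum>k\<in>(\<lambda>i. - int i) ` {1..p}. f k)"
    by (simp only:) (rule sum.union_disjoint; auto)
  also have "(\<Sum>k\<in>int ` {1..q} \<union> {0}. f k) = (\<Sum>k\<in>int ` {1..q}. f k) + (\<Sum>k\<in>{0}. f k)"
    by (rule sum.union_disjoint) auto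
  finally show ?thesis by (simp add: sum.reindex inj_on_def)
qed

section \<open>The type II recurrence along the four paths\<close>

context AT_pair
begin

text \<open>Paths and forms are arbitrary parameters so that the swapped interpretation yields type
  I. \<open>m_down\<close> reaches \<open>p + 1\<close>, since the coefficient at
  \<open>i = p\<close> involves a type I form at \<open>m - \<tt> (i + 1)\<close>.\<close>

lemma path_recurrence:
  assumes pq: "p \<ge> 1" "q \<ge> 1"
    and perms: "\<pi>\<^sub>s permutes {1..p}" "\<pi>\<^sub>\<ss> permutes {1..p}" "\<pi>\<^sub>t permutes {1..q}" "\<pi>\<^sub>\<tt> permutes {1..q}"
    and paths: "s = mpath p \<pi>\<^sub>s" "\<ss> = mpath p \<pi>\<^sub>\<ss>" "t = mpath q \<pi>\<^sub>t" "\<tt> = mpath q \<pi>\<^sub>\<tt>"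
    and A: "\<And>n m. multi_index p n \<Longrightarrow> multi_index q m \<Longrightarrow> msize p n = msize q m + 1 \<Longrightarrow>
      mixed_form w p u n q v m (A n m)"
    and B: "\<And>n m. multi_index p n \<Longrightarrow> multi_index q m \<Longrightarrow> msize q m = msize p n + 1 \<Longrightarrow>
      mixed_form w q v m p u n (B n m)"
    and n: "multi_index p n" and m: "multi_index q m" and size: "msize q m = msize p n + 1"
    and n_down: "\<And>i. i \<in> {1..p} \<Longrightarrow> 0 \<le> n - s i"
    and m_down: "\<And>i. i \<in> {1..p + 1} \<Longrightarrow> 0 \<le> m - \<tt> i"
  shows "\<And>j. j \<in> {1..q} \<Longrightarrow> pairing w (A (n + \<ss> (j + 1)) (m + t (j - 1))) (B (n + \<ss> j) (m + t j)) \<noteq> 0"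
    and "pairing w (A (n + \<ss> 1) (m - \<tt> 1)) (B n m) \<noteq> 0"
    and "\<And>i. i \<in> {1..p} \<Longrightarrow> pairing w (A (n - s (i - 1)) (m - \<tt> (i + 1))) (B (n - s i) (m - \<tt> i)) \<noteq> 0"
    and "\<And>x. x \<in> \<Delta> \<Longrightarrow> x * B n m x =
         (\<Sum>j=1..q. b_up w A B \<ss> t j n m * B (n + \<ss> j) (m + t j) x)
         + b_zero w A B \<ss> \<tt> n m * B n m x
         + (\<Sum>i=1..p. b_down w A B s \<tt> i n m * B (n - s i) (m - \<tt> i) x)"
proof -
  define N where "N = chain n \<ss> s"
  define M where "M = chain m t \<tt>"
  have zero: "s 0 = 0" "\<ss> 0 = 0" "t 0 = 0" "\<tt> 0 = 0" by (simp_all add: paths)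
  have N0: "N 0 = n" and M0: "M 0 = m" by (simp_all add: N_def M_def chain_def zero)
  have N_idx: "multi_index p (N k)" if "k \<in> {- int p..int q + 1}" for k
  proof -
    have "0 \<le> n - s i" if "k = - int i" for i
      using that \<open>k \<in> _\<close> n_down[of i] n by (cases "i = 0") (auto simp: zero multi_index_def)
    then show ?thesis
      unfolding N_def paths by (intro multi_index_chain perms pq n) auto
  qed
  have M_idx: "multi_index q (M k)" if "k \<in> {- int p - 1..int q}" for k
  proof -
    have "0 \<le> m - \<tt> i" if "k = - int i" for i
      using that \<open>k \<in> _\<close> m_down[of i] m by (cases "i = 0") (auto simp: zero multi_index_def)
    then show ?thesis
      unfolding M_def paths by (intro multi_index_chain perms pq m) auto
  qed
  have N_step: "\<exists>e\<in>{1..p}. N (k + 1) = N k + munit e" for k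
    unfolding N_def paths by (intro chain_step perms pq)
  have M_step: "\<exists>e\<in>{1..q}. M k = M (k - 1) + munit e" for k
    using chain_step[OF perms(3,4) pq(2), of m "k - 1"] by (simp add: M_def paths)
  have N_bot: "N (- int p) = N 0 - mones p"
    unfolding N0 using pq mpath_period[of p \<pi>\<^sub>s] by (simp add: N_def zero paths)
  have M_top: "M (int q) = M 0 + mones q"
    unfolding M0 using pq mpath_period[of q \<pi>\<^sub>t] by (simp add: M_def zero paths)
  have size': "msize q (M 0) = msize p (N 0) + 1" by (simp add: N0 M0 size)
  have nonzero: "pairing w (A (N (k + 1)) (M (k - 1))) (B (N k) (M k)) \<noteq> 0"
    if "k \<in> {- int p..int q}" for k
    using A B N_idx M_idx N_step M_step size' N_bot M_top that by (rule chain_recurrence(1))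
  have expansion: "x * B (N 0) (M 0) x =
      (\<Sum>k\<in>{- int p..int q}. pairing w (\<lambda>x. x * A (N (k + 1)) (M (k - 1)) x) (B (N 0) (M 0)) /
         pairing w (A (N (k + 1)) (M (k - 1))) (B (N k) (M k)) * B (N k) (M k) x)" if "x \<in> \<Delta>" for x
    using A B N_idx M_idx N_step M_step size' N_bot M_top that by (rule chain_recurrence(2))
  have up: "N (int j) = n + \<ss> j" "M (int j) = m + t j"
      "N (int j + 1) = n + \<ss> (j + 1)" "M (int j - 1) = m + t (j - 1)" if "j \<ge> 1" for j
    using that by (auto simp: N_def M_def chain_def nat_add_distrib nat_diff_distrib)
  have mid: "N (0 + 1) = n + \<ss> 1" "M (0 - 1) = m - \<tt> 1"
    by (auto simp: N_def M_def chain_def)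
  have down: "N (- int i) = n - s i" "M (- int i) = m - \<tt> i"
      "N (- int i + 1) = n - s (i - 1)" "M (- int i - 1) = m - \<tt> (i + 1)" if "i \<ge> 1" for i
  proof -
    have "- int i + 1 = - int (i - 1)" "- int i - 1 = - int (i + 1)" using that by auto
    then show "N (- int i) = n - s i" "M (- int i) = m - \<tt> i"
      "N (- int i + 1) = n - s (i - 1)" "M (- int i - 1) = m - \<tt> (i + 1)"
      by (simp_all only: N_def M_def chain_minus zero)
  qed
  show "pairing w (A (n + \<ss> (j + 1)) (m + t (j - 1))) (B (n + \<ss> j) (m + t j)) \<noteq> 0" if "j \<in> {1..q}" for j
    using nonzero[of "int j"] that by (simp add: up)
  show "pairing w (A (n + \<ss> 1) (m - \<tt> 1)) (B n m) \<noteq> 0"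
    using nonzero[of 0, unfolded mid N0 M0] by simp
  show "pairing w (A (n - s (i - 1)) (m - \<tt> (i + 1))) (B (n - s i) (m - \<tt> i)) \<noteq> 0" if "i \<in> {1..p}" for i
    using nonzero[of "- int i"] that by (simp only: down atLeastAtMost_iff) simp
  show "x * B n m x =
         (\<Sum>j=1..q. b_up w A B \<ss> t j n m * B (n + \<ss> j) (m + t j) x)
         + b_zero w A B \<ss> \<tt> n m * B n m x
         + (\<Sum>i=1..p. b_down w A B s \<tt> i n m * B (n - s i) (m - \<tt> i) x)" if "x \<in> \<Delta>" for x
  proof -
    have 1: "(\<Sum>j=1..q. pairing w (\<lambda>x. x * A (N (int j + 1)) (M (int j - 1)) x) (B n m) /
         pairing w (A (N (int j + 1)) (M (int j - 1))) (B (N (int j)) (M (int j))) * B (N (int j)) (M (int j)) x)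
       = (\<Sum>j=1..q. b_up w A B \<ss> t j n m * B (n + \<ss> j) (m + t j) x)"
      by (intro sum.cong) (auto simp: b_up_def up)
    have 2: "(\<Sum>i=1..p. pairing w (\<lambda>x. x * A (N (- int i + 1)) (M (- int i - 1)) x) (B n m) /
         pairing w (A (N (- int i + 1)) (M (- int i - 1))) (B (N (- int i)) (M (- int i))) * B (N (- int i)) (M (- int i)) x)
       = (\<Sum>i=1..p. b_down w A B s \<tt> i n m * B (n - s i) (m - \<tt> i) x)"
      by (intro sum.cong) (simp_all only: b_down_def down atLeastAtMost_iff)
    show ?thesis
      using expansion[OF that] unfolding sum_int_symmetric mid N0 M0 1 2 b_zero_def .
  qed
qed

end

section \<open>Both recurrences, type I by exchange of the two systems\<close>

theorem proposition2p1:
  fixes \<Delta> :: "real set" and w :: "real measure" and p q :: nat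
    and u v :: "nat \<Rightarrow> real \<Rightarrow> real"
    and \<pi>\<^sub>s \<pi>\<^sub>\<ss> \<pi>\<^sub>t \<pi>\<^sub>\<tt> :: "nat \<Rightarrow> nat"
    and s \<ss> t \<tt> :: "nat \<Rightarrow> mindex"
    and A B :: "mindex \<Rightarrow> mindex \<Rightarrow> real \<Rightarrow> real"
    and n m :: mindex
  assumes "p \<ge> 1" and "q \<ge> 1"
    and "is_interval \<Delta>"
    and "sets w = sets (restrict_space borel \<Delta>)"
    and infinite_support: "\<And>F. finite F \<Longrightarrow> F \<subseteq> \<Delta> \<Longrightarrow> emeasure w (\<Delta> - F) > 0"
    and "\<And>i. i \<in> {1..p} \<Longrightarrow> u i \<in> borel_measurable w"
    and "\<And>j. j \<in> {1..q} \<Longrightarrow> v j \<in> borel_measurable w"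
    and "\<And>i x. i \<in> {1..p} \<Longrightarrow> x \<in> \<Delta> \<Longrightarrow> u i x > 0"
    and "\<And>j x. j \<in> {1..q} \<Longrightarrow> x \<in> \<Delta> \<Longrightarrow> v j x > 0"
    and "\<And>r i j. i \<in> {1..p} \<Longrightarrow> j \<in> {1..q} \<Longrightarrow> integrable w (\<lambda>x. \<bar>x\<bar> ^ r * u i x * v j x)"
    and "AT_system \<Delta> p u" and "AT_system \<Delta> q v"
    and "\<pi>\<^sub>s permutes {1..p}" and "\<pi>\<^sub>\<ss> permutes {1..p}"
    and "\<pi>\<^sub>t permutes {1..q}" and "\<pi>\<^sub>\<tt> permutes {1..q}"
    and "s = mpath p \<pi>\<^sub>s" and "\<ss> = mpath p \<pi>\<^sub>\<ss>"
    and "t = mpath q \<pi>\<^sub>t" and "\<tt> = mpath q \<pi>\<^sub>\<tt>"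
    and "\<And>n' m'. multi_index p n' \<Longrightarrow> multi_index q m' \<Longrightarrow> msize p n' = msize q m' + 1 \<Longrightarrow>
           type_I_form w p q u v n' m' (A n' m')"
    and "\<And>n' m'. multi_index p n' \<Longrightarrow> multi_index q m' \<Longrightarrow> msize q m' = msize p n' + 1 \<Longrightarrow>
           type_II_form w p q u v n' m' (B n' m')"
    and "multi_index p n" and "multi_index q m"
    and "\<And>i. i \<in> {1..p} \<Longrightarrow> n i > 0" and "\<And>j. j \<in> {1..q} \<Longrightarrow> m j > 0"
  shows
    "(msize q m = msize p n + 1 \<and>
      0 \<le> m - \<tt> 1 \<and>
      (\<forall>i\<in>{1..p}. 0 \<le> n - s i \<and> 0 \<le> m - \<tt> i \<and> 0 \<le> n - s (i - 1) \<and> 0 \<le> m - \<tt> (i + 1))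
      \<longrightarrow>
      (\<forall>j\<in>{1..q}. pairing w (A (n + \<ss> (j + 1)) (m + t (j - 1))) (B (n + \<ss> j) (m + t j)) \<noteq> 0) \<and>
      pairing w (A (n + \<ss> 1) (m - \<tt> 1)) (B n m) \<noteq> 0 \<and>
      (\<forall>i\<in>{1..p}. pairing w (A (n - s (i - 1)) (m - \<tt> (i + 1))) (B (n - s i) (m - \<tt> i)) \<noteq> 0) \<and>
      (\<forall>x\<in>\<Delta>. x * B n m x =
         (\<Sum>j=1..q. b_up w A B \<ss> t j n m * B (n + \<ss> j) (m + t j) x)
         + b_zero w A B \<ss> \<tt> n m * B n m x
         + (\<Sum>i=1..p. b_down w A B s \<tt> i n m * B (n - s i) (m - \<tt> i) x)))
     \<and>
     (msize p n = msize q m + 1 \<and>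
      0 \<le> n - \<ss> 1 \<and>
      (\<forall>j\<in>{1..q}. 0 \<le> n - \<ss> j \<and> 0 \<le> m - t j \<and> 0 \<le> n - \<ss> (j + 1) \<and> 0 \<le> m - t (j - 1) \<and>
         0 \<le> n - \<ss> (j + 1) + \<ss> j \<and> 0 \<le> m - t (j - 1) + t j) \<and>
      (\<forall>i\<in>{1..p}. 0 \<le> n - s i + s (i - 1) \<and> 0 \<le> m - \<tt> i + \<tt> (i + 1))
      \<longrightarrow>
      (\<forall>j\<in>{1..q}. pairing w (B (n - \<ss> (j + 1) + \<ss> j) (m - t (j - 1) + t j)) (A n m) \<noteq> 0 \<and>
         pairing w (B (n - \<ss> (j + 1)) (m - t (j - 1))) (A (n - \<ss> j) (m - t j)) \<noteq> 0) \<and>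
      pairing w (B (n - \<ss> 1) (m + \<tt> 1)) (A n m) \<noteq> 0 \<and>
      (\<forall>i\<in>{1..p}. pairing w (B (n - s i + s (i - 1)) (m - \<tt> i + \<tt> (i + 1))) (A n m) \<noteq> 0 \<and>
         pairing w (B (n + s (i - 1)) (m + \<tt> (i + 1))) (A (n + s i) (m + \<tt> i)) \<noteq> 0) \<and>
      (\<forall>x\<in>\<Delta>. x * A n m x =
         (\<Sum>j=1..q. a_down w A B \<ss> t j n m * A (n - \<ss> j) (m - t j) x)
         + a_zero w A B \<ss> \<tt> n m * A n m x
         + (\<Sum>i=1..p. a_up w A B s \<tt> i n m * A (n + s i) (m + \<tt> i) x)))"
proof -
  note pq = assms(1,2) and perms = assms(13-16) and paths = assms(17-20) and nm = assms(23,24)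
  have meas: "(\<lambda>x. x) \<in> borel_measurable w"
    by (rule measurable_cong_sets[OF assms(4) refl, THEN equalityD2, THEN subsetD])
      (simp add: measurable_restrict_space1)
  interpret AT_pair \<Delta> w p q u v
  proof
    fix r i j assume ij: "i \<in> {1..p}" "j \<in> {1..q}"
    have [measurable]: "u i \<in> borel_measurable w" "v j \<in> borel_measurable w" "(\<lambda>x. x) \<in> borel_measurable w"
      using assms(6,7) ij meas by auto
    show "integrable w (\<lambda>x. x ^ r * u i x * v j x)"
      by (rule Bochner_Integration.integrable_bound[OF assms(10)[OF ij, of r]])
        (auto simp: abs_mult power_abs)
  qed (use assms in auto)
  interpret swapped: AT_pair \<Delta> w q p v u by (rule swap)
  have A: "mixed_form w p u n q v m (A n m)"
    if "multi_index p n" "multi_index q m" "msize p n = msize q m + 1" for n m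
    using assms(21)[OF that] by (simp add: type_I_form_def)
  have B: "mixed_form w q v m p u n (B n m)"
    if "multi_index p n" "multi_index q m" "msize q m = msize p n + 1" for n m
    using assms(22)[OF that] by (simp add: type_II_form_def)
  have pairing_commute: "pairing w F G = pairing w G F" for F G
    by (simp add: pairing_def mult.commute)
  have pairing_shift: "pairing w (\<lambda>x. x * F x) G = pairing w (\<lambda>x. x * G x) F" for F G
    by (simp add: pairing_def ac_simps)
  show ?thesis
  proof (rule conjI; rule impI)
    assume hyp: "msize q m = msize p n + 1 \<and> 0 \<le> m - \<tt> 1 \<and>
      (\<forall>i\<in>{1..p}. 0 \<le> n - s i \<and> 0 \<le> m - \<tt> i \<and> 0 \<le> n - s (i - 1) \<and> 0 \<le> m - \<tt> (i + 1))"
    have size: "msize q m = msize p n + 1" and n_down: "\<And>i. i \<in> {1..p} \<Longrightarrow> 0 \<le> n - s i"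
      using hyp by auto
    have m_down: "0 \<le> m - \<tt> i" if "i \<in> {1..p + 1}" for i
    proof (cases "i = p + 1")
      case True
      \<comment> \<open>The bound at \<open>p + 1\<close> is the condition on
        \<open>\<tt> (i + 1)\<close> at \<open>i = p\<close>.\<close>
      have "p \<in> {1..p}" using pq by simp
      then show ?thesis using hyp True by blast
    qed (use hyp that in auto)
    note rec = path_recurrence[OF pq perms paths A B nm size n_down m_down]
    show "(\<forall>j\<in>{1..q}. pairing w (A (n + \<ss> (j + 1)) (m + t (j - 1))) (B (n + \<ss> j) (m + t j)) \<noteq> 0) \<and>
      pairing w (A (n + \<ss> 1) (m - \<tt> 1)) (B n m) \<noteq> 0 \<and>
      (\<forall>i\<in>{1..p}. pairing w (A (n - s (i - 1)) (m - \<tt> (i + 1))) (B (n - s i) (m - \<tt> i)) \<noteq> 0) \<and>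
      (\<forall>x\<in>\<Delta>. x * B n m x =
         (\<Sum>j=1..q. b_up w A B \<ss> t j n m * B (n + \<ss> j) (m + t j) x)
         + b_zero w A B \<ss> \<tt> n m * B n m x
         + (\<Sum>i=1..p. b_down w A B s \<tt> i n m * B (n - s i) (m - \<tt> i) x))"
      by (intro conjI ballI rec)
  next
    assume hyp: "msize p n = msize q m + 1 \<and> 0 \<le> n - \<ss> 1 \<and>
      (\<forall>j\<in>{1..q}. 0 \<le> n - \<ss> j \<and> 0 \<le> m - t j \<and> 0 \<le> n - \<ss> (j + 1) \<and> 0 \<le> m - t (j - 1) \<and>
         0 \<le> n - \<ss> (j + 1) + \<ss> j \<and> 0 \<le> m - t (j - 1) + t j) \<and>
      (\<forall>i\<in>{1..p}. 0 \<le> n - s i + s (i - 1) \<and> 0 \<le> m - \<tt> i + \<tt> (i + 1))"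
    have size: "msize p n = msize q m + 1" and m_down: "\<And>j. j \<in> {1..q} \<Longrightarrow> 0 \<le> m - t j"
      using hyp by auto
    have n_down: "0 \<le> n - \<ss> j" if "j \<in> {1..q + 1}" for j
    proof (cases "j = q + 1")
      case True
      have "q \<in> {1..q}" using pq by simp
      then show ?thesis using hyp True by blast
    qed (use hyp that in auto)
    \<comment> \<open>After the exchange the index belonging to \<open>v\<close> comes first, so
      both families take their arguments in reverse order, and \<open>t\<close>,
      \<open>\<tt>\<close> trade places with \<open>s\<close>, \<open>\<ss>\<close>.\<close>
    let ?A = "\<lambda>m n. A n m" and ?B = "\<lambda>m n. B n m"
    note rec = swapped.path_recurrence[of \<pi>\<^sub>t \<pi>\<^sub>\<tt> \<pi>\<^sub>s \<pi>\<^sub>\<ss> t \<tt> s \<ss> ?B ?A m n,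
        OF pq(2,1) perms(3,4,1,2) paths(3,4,1,2) B A nm(2,1) size m_down n_down]
    \<comment> \<open>These pairings are not among the denominators of the swapped recurrence; they
      appear because the type I coefficients are written through shifted type II ones. Their indices
      are \<open>n\<close> minus a unit and \<open>m\<close> plus a unit, so the balanced pair is
      the former together with \<open>m\<close>.\<close>
    have nonzero: "pairing w (B (n - k' + k) (m - l + l')) (A n m) \<noteq> 0"
      if "0 \<le> n - k' + k" "e \<in> {1..p}" "k' = k + munit e" "e' \<in> {1..q}" "l' = l + munit e'" for k k' l l' e e'
    proof -
      define n1 where "n1 = n - k' + k"
      have n1: "n = n1 + munit e" "m - l + l' = m + munit e'" using that by (auto simp: n1_def)
      have idx: "multi_index p n1"
        using nm(1) that(1,2) n1(1) unfolding n1_def[symmetric]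
        by (auto simp: multi_index_def munit_def)
      have "msize p n1 = msize q m" using size that(2) n1(1) msize_add_munit[of e p n1] by simp
      moreover have "multi_index q (m + munit e')"
        using nm(2) that(4) by (auto simp: multi_index_def munit_def le_fun_def)
      moreover have "msize q (m + munit e') = msize q m + 1" using that(4) by (rule msize_add_munit)
      ultimately have "pairing w (A n m) (B n1 (m + munit e')) \<noteq> 0"
        using A[OF nm size] B[of n1 "m + munit e'"] idx n1(1) nm(2)
        by (intro pairing_nonzero[OF idx that(2) nm(2) that(4)]) auto
      then show ?thesis by (simp add: n1(2) n1_def[symmetric] pairing_commute)
    qed
    have nz_down: "pairing w (B (n - \<ss> (j + 1) + \<ss> j) (m - t (j - 1) + t j)) (A n m) \<noteq> 0"
      if j: "j \<in> {1..q}" for j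
    proof -
      obtain e where e: "e \<in> {1..p}" "\<ss> (j + 1) = \<ss> j + munit e"
        using mpath_Suc[OF perms(2) pq(1), of j] paths by auto
      obtain e' where e': "e' \<in> {1..q}" "t j = t (j - 1) + munit e'"
        using mpath_Suc[OF perms(3) pq(2), of "j - 1"] paths j by auto
      show ?thesis by (rule nonzero[OF _ e e']) (use hyp j in blast)
    qed
    have nz_up: "pairing w (B (n - s i + s (i - 1)) (m - \<tt> i + \<tt> (i + 1))) (A n m) \<noteq> 0"
      if i: "i \<in> {1..p}" for i
    proof -
      obtain e where e: "e \<in> {1..p}" "s i = s (i - 1) + munit e"
        using mpath_Suc[OF perms(1) pq(1), of "i - 1"] paths i by auto
      obtain e' where e': "e' \<in> {1..q}" "\<tt> (i + 1) = \<tt> i + munit e'"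
        using mpath_Suc[OF perms(4) pq(2), of i] paths by auto
      show ?thesis by (rule nonzero[OF _ e e']) (use hyp i in blast)
    qed
    \<comment> \<open>The denominator of the shifted \<open>b_up\<close> is the very pairing by
      which it is multiplied. It cancels, being nonzero, and the type I quotient remains once x is
      moved from one form to the other.\<close>
    have a_down: "a_down w A B \<ss> t j n m = b_down w ?B ?A t \<ss> j m n" if "j \<in> {1..q}" for j
      using nz_down[OF that]
      by (simp add: a_down_def b_up_def b_down_def pairing_shift[of "A n m"] pairing_commute[of "A n m"])
    \<comment> \<open>The same cancellation; \<open>diff_add_eq\<close> reconciles
      \<open>n - s i + s (i - 1)\<close> with the order of terms produced by the shift.\<close>
    have a_up: "a_up w A B s \<tt> i n m = b_up w ?B ?A \<tt> s i m n" if "i \<in> {1..p}" for i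
      using nz_up[OF that]
      by (simp add: a_up_def b_up_def b_down_def diff_add_eq pairing_shift[of "A n m"]
          pairing_commute[of "A n m"])
    have a_zero: "a_zero w A B \<ss> \<tt> n m = b_zero w ?B ?A \<tt> \<ss> m n"
      by (simp add: a_zero_def b_zero_def pairing_shift[of "A n m"] pairing_commute[of "A n m"])
    show "(\<forall>j\<in>{1..q}. pairing w (B (n - \<ss> (j + 1) + \<ss> j) (m - t (j - 1) + t j)) (A n m) \<noteq> 0 \<and>
         pairing w (B (n - \<ss> (j + 1)) (m - t (j - 1))) (A (n - \<ss> j) (m - t j)) \<noteq> 0) \<and>
      pairing w (B (n - \<ss> 1) (m + \<tt> 1)) (A n m) \<noteq> 0 \<and>
      (\<forall>i\<in>{1..p}. pairing w (B (n - s i + s (i - 1)) (m - \<tt> i + \<tt> (i + 1))) (A n m) \<noteq> 0 \<and>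
         pairing w (B (n + s (i - 1)) (m + \<tt> (i + 1))) (A (n + s i) (m + \<tt> i)) \<noteq> 0) \<and>
      (\<forall>x\<in>\<Delta>. x * A n m x =
         (\<Sum>j=1..q. a_down w A B \<ss> t j n m * A (n - \<ss> j) (m - t j) x)
         + a_zero w A B \<ss> \<tt> n m * A n m x
         + (\<Sum>i=1..p. a_up w A B s \<tt> i n m * A (n + s i) (m + \<tt> i) x))"
    proof (intro conjI ballI)
      fix x assume x: "x \<in> \<Delta>"
      have "(\<Sum>j=1..q. a_down w A B \<ss> t j n m * A (n - \<ss> j) (m - t j) x) =
          (\<Sum>j=1..q. b_down w ?B ?A t \<ss> j m n * A (n - \<ss> j) (m - t j) x)"
        by (intro sum.cong refl) (simp only: a_down)
      moreover have "(\<Sum>i=1..p. a_up w A B s \<tt> i n m * A (n + s i) (m + \<tt> i) x) =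
          (\<Sum>i=1..p. b_up w ?B ?A \<tt> s i m n * A (n + s i) (m + \<tt> i) x)"
        by (intro sum.cong refl) (simp only: a_up)
      moreover have "x * A n m x = (\<Sum>i=1..p. b_up w ?B ?A \<tt> s i m n * A (n + s i) (m + \<tt> i) x)
          + b_zero w ?B ?A \<tt> \<ss> m n * A n m x
          + (\<Sum>j=1..q. b_down w ?B ?A t \<ss> j m n * A (n - \<ss> j) (m - t j) x)"
        using x by (intro rec(4))
      ultimately show "x * A n m x =
         (\<Sum>j=1..q. a_down w A B \<ss> t j n m * A (n - \<ss> j) (m - t j) x)
         + a_zero w A B \<ss> \<tt> n m * A n m x
         + (\<Sum>i=1..p. a_up w A B s \<tt> i n m * A (n + s i) (m + \<tt> i) x)"
        unfolding a_zero by linarith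
    qed (rule nz_down nz_up rec(1-3), assumption+)+
  qed
qed

end
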